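(* Let $0\le m\le n$ and let $C\subseteq\Delta_n^m$ be a weakly separated collection of maximum cardinality among weakly separated collections contained in $\Delta_n^m$. If $C\ne\mathcal{IS}_n^m$, then $C$ admits a lowering 4-flip. In particular, all weakly separated collections in $\Delta_n^m$ of maximum cardinality are obtained from one another by finite sequences of 4-flips.
   Context: Notation: $[n]=\{1,\dots,n\}$, $[p..q]=\{p,\dots,q\}$; $Xij=X\cup\{i,j\}$ etc. $\Delta_n^m=\{S\subseteq[n]:|S|=m\}$. $\mathcal{IS}_n^m$ is the collection of all $m$-element intervals $[p..q]$ in $[n]$ together with all $m$-element sets of the form $[1..p]\cup[q..r]$ with $p\ge1$, $q\le r$ and $q>p+1$. Weak separation. For $X,Y\subseteq[n]$, $X\prec Y$ means $Y\setminus X\ne\emptyset$ and $i<j$ for all $i\in X\setminus Y$, $j\in Y\setminus X$. $X\rhd Y$ means $Y\setminus X$ has a bipartition $\{Y_1,Y_2\}$ with $Y_1,Y_2,X\setminus Y$ nonempty and $Y_1\prec X\setminus Y\prec Y_2$. $X,Y$ are weakly separated if $X\prec Y$, or $Y\prec X$, or ($X\rhd Y$ and $|X|\ge|Y|$), or ($Y\rhd X$ and $|Y|\ge|X|$). A collection is weakly separated if any two members are. 4-flips. For $i<j<k<\ell$ in $[n]$ and $X\subseteq[n]\setminus\{i,j,k,\ell\}$ with $|X|=m-2$: if a collection contains $Xij,Xk\ell,Xi\ell,Xjk$ and exactly one $Y\in\{Xik,Xj\ell\}$, a 4-flip replaces $Y$ by the other member; it is lowering if $Y=Xj\ell$ (replaced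 by $Xik$) and raising if $Y=Xik$. *)

theory Defs
  imports Main
begin

definition Delta :: "nat \<Rightarrow> nat \<Rightarrow> nat set set" where
  "Delta n m = {S. S \<subseteq> {1..n} \<and> card S = m}"

text \<open>In the first family \<open>q < p\<close> is possible, and \<open>{p..q}\<close> is then empty. This matters only
  for \<open>m = 0\<close>, where the empty set counts as the interval with no elements, so that
  \<open>IS n 0 = {{}}\<close>.\<close>

definition IS :: "nat \<Rightarrow> nat \<Rightarrow> nat set set" where
  "IS n m =
     {S. card S = m \<and> (\<exists>p q. 1 \<le> p \<and> q \<le> n \<and> S = {p..q})} \<union>
     {S. card S = m \<and> (\<exists>p q r. 1 \<le> p \<and> p + 1 < q \<and> q \<le> r \<and> r \<le> n \<and> S = {1..p} \<union> {q..r})}"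

definition set_prec :: "nat set \<Rightarrow> nat set \<Rightarrow> bool" where
  "set_prec X Y \<longleftrightarrow> Y - X \<noteq> {} \<and> (\<forall>i\<in>X - Y. \<forall>j\<in>Y - X. i < j)"

definition set_surr :: "nat set \<Rightarrow> nat set \<Rightarrow> bool" where
  "set_surr X Y \<longleftrightarrow>
     (\<exists>Y1 Y2. Y1 \<union> Y2 = Y - X \<and> Y1 \<inter> Y2 = {} \<and>
        Y1 \<noteq> {} \<and> Y2 \<noteq> {} \<and> X - Y \<noteq> {} \<and>
        set_prec Y1 (X - Y) \<and> set_prec (X - Y) Y2)"

definition weakly_separated :: "nat set \<Rightarrow> nat set \<Rightarrow> bool" where
  "weakly_separated X Y \<longleftrightarrow>
     set_prec X Y \<or> set_prec Y X \<or>
     (set_surr X Y \<and> card X \<ge> card Y) \<or>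
     (set_surr Y X \<and> card Y \<ge> card X)"

text \<open>Only distinct members are compared: \<open>weakly_separated X X\<close> is false for every \<open>X\<close>.\<close>

definition ws_collection :: "nat set set \<Rightarrow> bool" where
  "ws_collection C \<longleftrightarrow> (\<forall>X\<in>C. \<forall>Y\<in>C. X \<noteq> Y \<longrightarrow> weakly_separated X Y)"

definition max_ws_collection :: "nat \<Rightarrow> nat \<Rightarrow> nat set set \<Rightarrow> bool" where
  "max_ws_collection n m C \<longleftrightarrow>
     C \<subseteq> Delta n m \<and> ws_collection C \<and>
     (\<forall>D. D \<subseteq> Delta n m \<and> ws_collection D \<longrightarrow> card D \<le> card C)"

text \<open>The condition \<open>card X + 2 = m\<close> renders \<open>|X| = m - 2\<close> without truncated subtraction,
  so there are no flips for \<open>m < 2\<close>.\<close>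

definition flip_frame ::
    "nat \<Rightarrow> nat \<Rightarrow> nat set set \<Rightarrow> nat set \<Rightarrow> nat \<Rightarrow> nat \<Rightarrow> nat \<Rightarrow> nat \<Rightarrow> bool" where
  "flip_frame n m C X i j k l \<longleftrightarrow>
     1 \<le> i \<and> i < j \<and> j < k \<and> k < l \<and> l \<le> n \<and>
     X \<subseteq> {1..n} - {i, j, k, l} \<and> card X + 2 = m \<and>
     X \<union> {i, j} \<in> C \<and> X \<union> {k, l} \<in> C \<and> X \<union> {i, l} \<in> C \<and> X \<union> {j, k} \<in> C"

definition lowering_flip :: "nat \<Rightarrow> nat \<Rightarrow> nat set set \<Rightarrow> nat set set \<Rightarrow> bool" where
  "lowering_flip n m C C' \<longleftrightarrow>
     (\<exists>X i j k l. flip_frame n m C X i j k l \<and>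
        X \<union> {j, l} \<in> C \<and> X \<union> {i, k} \<notin> C \<and>
        C' = (C - {X \<union> {j, l}}) \<union> {X \<union> {i, k}})"

definition raising_flip :: "nat \<Rightarrow> nat \<Rightarrow> nat set set \<Rightarrow> nat set set \<Rightarrow> bool" where
  "raising_flip n m C C' \<longleftrightarrow>
     (\<exists>X i j k l. flip_frame n m C X i j k l \<and>
        X \<union> {i, k} \<in> C \<and> X \<union> {j, l} \<notin> C \<and>
        C' = (C - {X \<union> {i, k}}) \<union> {X \<union> {j, l}})"

definition four_flip :: "nat \<Rightarrow> nat \<Rightarrow> nat set set \<Rightarrow> nat set set \<Rightarrow> bool" where
  "four_flip n m C C' \<longleftrightarrow> lowering_flip n m C C' \<or> raising_flip n m C C'"

end

theory Submission
  imports Defs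
begin

text \<open>
  For sets of equal size weak separation means that the two differences do not interlace on a
  circle. Replacing the smallest label \<open>e\<close> of a set by the first label missing from it keeps sets
  non-interlacing. Within a fibre of this push map the members are told apart by the missing label,
  and a label can be a non-minimal one in only one fibre. Hence a collection loses at most \<open>m\<close> members,
  which bounds its size by \<open>m (n - m) + 1\<close>; for collections of that size, pushing again gives a
  collection of maximum size, and every label that occurs is non-minimal in exactly one fibre.

  By induction through the push map, rotation and complementation, this tightness shows that every
  edge \<open>W \<union> {p}\<close>, \<open>W \<union> {q}\<close> that is not on the boundary has a third vertex on each side.

  Call \<open>C1\<close> the collection of all \<open>Y\<close> with \<open>Y \<union> {n}\<close> in \<open>C\<close>. If \<open>C1\<close> contains more than the cyclic intervals,
  there is an \<open>m\<close>-set \<open>T\<close> outside \<open>C\<close> for which two sets \<open>T - {a}\<close> and \<open>T - {b}\<close> lie in \<open>C1\<close>. Take \<open>T\<close> interlacing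
  with as few members as possible and \<open>a\<close>, \<open>b\<close> extreme. The third vertex of this edge must be \<open>X \<union> {v}\<close> with
  \<open>X = T - {a, b}\<close> and \<open>a < v < b\<close>, and minimality of \<open>T\<close> puts \<open>X \<union> {a, v}\<close> and \<open>X \<union> {v, b}\<close> into \<open>C\<close>, so that
  \<open>X \<union> {v, n}\<close> can be flipped to \<open>X \<union> {a, b}\<close>. Otherwise the sets containing \<open>n\<close> are the same as in \<open>IS\<close>, and
  one removes them and proceeds by induction on \<open>n\<close>.
\<close>

section \<open>Interlacing sets\<close>

text \<open>The two differences alternate around a circle. Admitting the fourth point at either end
  makes the relation symmetric; for distinct sets of equal size it is the failure of weak
  separation.\<close>

definition crosses :: "nat set \<Rightarrow> nat set \<Rightarrow> bool" where
  "crosses A B \<longleftrightarrow> (\<exists>a b c d. a \<in> A - B \<and> c \<in> A - B \<and> b \<in> B - A \<and> d \<in> B - A \<and>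
     a < b \<and> b < c \<and> (c < d \<or> d < a))"

lemma crossesI:
  "a \<in> A \<Longrightarrow> a \<notin> B \<Longrightarrow> c \<in> A \<Longrightarrow> c \<notin> B \<Longrightarrow> b \<in> B \<Longrightarrow> b \<notin> A \<Longrightarrow> d \<in> B \<Longrightarrow> d \<notin> A \<Longrightarrow>
    a < b \<Longrightarrow> b < c \<Longrightarrow> c < d \<or> d < a \<Longrightarrow> crosses A B"
  unfolding crosses_def by blast

lemma crosses_sym: "crosses A B \<longleftrightarrow> crosses B A"
  unfolding crosses_def by blast

lemma not_crosses_refl [simp]: "\<not> crosses A A"
  unfolding crosses_def by blast

definition noncrossing :: "nat set set \<Rightarrow> bool" where
  "noncrossing C \<longleftrightarrow> (\<forall>A\<in>C. \<forall>B\<in>C. \<not> crosses A B)"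

lemma noncrossingD: "noncrossing C \<Longrightarrow> A \<in> C \<Longrightarrow> B \<in> C \<Longrightarrow> \<not> crosses A B"
  unfolding noncrossing_def by blast

lemma finite_family: "finite G \<Longrightarrow> C \<subseteq> {S. S \<subseteq> G \<and> card S = m} \<Longrightarrow> finite C"
  by (rule finite_subset[of _ "Pow G"]) auto

lemma ex_in_diff:
  assumes "finite A" "finite B" "card A = card B" "A \<noteq> B"
  shows "\<exists>x. x \<in> A - B"
proof (rule ccontr)
  assume "\<nexists>x. x \<in> A - B"
  hence "A \<subseteq> B" by blast
  thus False using card_subset_eq[OF assms(2)] assms(3,4) by blast
qed

text \<open>The two differences have equal size, so \<open>B - A\<close> has at least two elements
  as well. This supplies the extra point of a crossing while avoiding a known point
  \<open>w\<close>.\<close>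

lemma ex_other_in_diff:
  assumes "finite A" "finite B" "card A = card B"
    and "x \<in> A - B" "y \<in> A - B" "x \<noteq> y"
  shows "\<exists>z\<in>B - A. z \<noteq> w"
proof (rule ccontr)
  assume "\<not> ?thesis"
  hence "B - A \<subseteq> {w}" by blast
  hence 1: "card (B - A) \<le> 1" using card_mono[of "{w}" "B - A"] by simp
  have "{x, y} \<subseteq> A - B" using assms by blast
  hence "2 \<le> card (A - B)" using card_mono[of "A - B" "{x,y}"] assms by simp
  moreover have "card (A - B) = card (B - A)"
    using assms(1-3) by (simp add: card_Diff_subset_Int Int_commute)
  ultimately show False using 1 by simp
qed

section \<open>Pushing the smallest element\<close>

definition gap :: "nat set \<Rightarrow> nat set \<Rightarrow> nat" where
  "gap G U = Min (G - U)"

text \<open>If \<open>Min G\<close> is missing from a proper subset \<open>U\<close> of a finite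
  \<open>G\<close>, it is itself the gap, and \<open>U\<close> stays fixed.\<close>

definition push :: "nat set \<Rightarrow> nat set \<Rightarrow> nat set" where
  "push G U = insert (gap G U) U - {Min G}"

lemma gap_props:
  assumes "finite G" "U \<subseteq> G" "card U < card G"
  shows "gap G U \<in> G" "gap G U \<notin> U" "\<And>g. g \<in> G \<Longrightarrow> g < gap G U \<Longrightarrow> g \<in> U" "Min G \<le> gap G U"
proof -
  have ne: "G - U \<noteq> {}" using assms by (metis Diff_eq_empty_iff card_mono finite_subset not_le)
  have "gap G U \<in> G - U" unfolding gap_def using assms(1) ne by (intro Min_in) auto
  thus 1: "gap G U \<in> G" "gap G U \<notin> U" by auto
  show "g \<in> U" if "g \<in> G" "g < gap G U" for g
    using that Min_le[of "G - U" g] assms(1) unfolding gap_def by fastforce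
  show "Min G \<le> gap G U" using 1 assms(1) by simp
qed

text \<open>\<open>Min G\<close> belongs to \<open>U\<close> or is its gap, so passing to the image
  forgets nothing but the gap.\<close>

lemma push_inverse:
  assumes "finite G" "U \<subseteq> G" "card U < card G"
  shows "U = insert (Min G) (push G U) - {gap G U}"
proof -
  have "Min G \<in> U \<or> Min G = gap G U"
    using gap_props[OF assms] assms by (metis Min_in card.empty le_neq_implies_less not_less_zero)
  thus ?thesis using gap_props(2)[OF assms] unfolding push_def by auto
qed

lemma push_below:
  assumes "finite G" "U \<subseteq> G" "card U < card G" "g \<in> G" "Min G < g" "g \<le> gap G U"
  shows "g \<in> push G U"
  using gap_props[OF assms(1-3)] assms(4-6) unfolding push_def by (cases "g = gap G U") auto

lemma push_subset:
  assumes "finite G" "U \<subseteq> G" "card U < card G"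
  shows "push G U \<subseteq> G - {Min G}" "card (push G U) = card U"
proof -
  show "push G U \<subseteq> G - {Min G}" using gap_props[OF assms] assms unfolding push_def by auto
  have fU: "finite U" using assms finite_subset by blast
  have "Min G \<in> U \<or> Min G = gap G U"
    using gap_props[OF assms] assms by (metis Min_in card.empty le_neq_implies_less not_less_zero)
  hence "Min G \<in> insert (gap G U) U" by blast
  hence "card (push G U) = card (insert (gap G U) U) - 1"
    unfolding push_def using fU by (simp add: card_Diff_singleton)
  thus "card (push G U) = card U" using gap_props(2)[OF assms] fU by simp
qed

text \<open>All labels below the gap \<open>z\<close> of \<open>V\<close> lie in \<open>V\<close>,
  so the points of \<open>push G U - push G V\<close> lie above \<open>z\<close>. In the other
  difference only \<open>z\<close> can be new, and the gap \<open>y\<close> of \<open>U\<close>, an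
  element of \<open>V - U\<close> below \<open>z\<close>, can take its place.\<close>

lemma crosses_push_aux:
  assumes G: "finite G" "U \<subseteq> G" "card U < card G" "V \<subseteq> G" "card V < card G"
    and le: "gap G U < gap G V"
    and cr: "crosses (push G U) (push G V)"
  shows "crosses U V"
proof -
  define e y z where d: "e = Min G" "y = gap G U" "z = gap G V"
  note gU = gap_props[OF G(1,2,3)] and gV = gap_props[OF G(1,4,5)]
  have ym: "y \<in> V" "y \<notin> U" using gV(3)[OF gU(1)] gU le d by auto
  have eV: "e \<in> V" using gV(3)[of e] gU(4) le d G
    by (metis Min_in card.empty le_less_trans not_less_zero)
  have eU: "e \<in> U \<or> e = y" using gU d G by (metis Min_in card.empty le_neq_implies_less not_less_zero)
  have 1: "push G U - push G V \<subseteq> U - V - {z}"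
    using ym eV eU unfolding push_def d[symmetric] by auto
  have 2: "push G V - push G U \<subseteq> insert z (V - U - {y})"
    using ym eV eU unfolding push_def d[symmetric] by auto
  have big: "z < x" if "x \<in> U - V - {z}" for x
  proof -
    have "x \<in> G" using that G by blast
    thus ?thesis using that gV(3)[of x] d by (metis Diff_iff antisym_conv3 insertI1)
  qed
  obtain a b c t where q: "a \<in> push G U - push G V" "c \<in> push G U - push G V"
    "b \<in> push G V - push G U" "t \<in> push G V - push G U" "a < b" "b < c" "c < t \<or> t < a"
    using cr unfolding crosses_def by blast
  have ac: "a \<in> U - V" "c \<in> U - V" "z < a" "z < c" using q 1 big by auto
  have "b \<in> V - U" using q 2 ac by auto
  moreover have "t \<in> V - U \<or> t = z" using q 2 by auto
  ultimately show ?thesis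
  proof (elim disjE)
    assume "t = z"
    have "y < z" using le d by simp
    thus ?thesis using ac \<open>b \<in> V - U\<close> ym q
      by (intro crossesI[of a U V c b y]) auto
  qed (use ac q in \<open>auto intro: crossesI[of a U V c b t]\<close>)
qed

lemma crosses_push:
  assumes G: "finite G" "U \<subseteq> G" "card U < card G" "V \<subseteq> G" "card V < card G"
    and cr: "crosses (push G U) (push G V)"
  shows "crosses U V"
proof -
  consider "gap G U < gap G V" | "gap G V < gap G U" | "gap G U = gap G V" by linarith
  thus ?thesis
  proof cases
    case 1 thus ?thesis using crosses_push_aux assms by blast
  next
    case 2 thus ?thesis using crosses_push_aux[of G V U] assms crosses_sym by blast
  next
    case 3
    have "Min G \<in> U \<or> Min G = gap G U" "Min G \<in> V \<or> Min G = gap G V"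
      using gap_props[OF G(1,2,3)] gap_props[OF G(1,4,5)] G
      by (metis Min_in card.empty le_neq_implies_less not_less_zero)+
    hence "push G U - push G V = U - V" "push G V - push G U = V - U"
      using 3 gap_props(2)[OF G(1,2,3)] gap_props(2)[OF G(1,4,5)] unfolding push_def by auto
    thus ?thesis using cr unfolding crosses_def by simp
  qed
qed

text \<open>Members of one fibre of the push map differ only in their gap, so the number of nonleast members
  is what is lost in cardinality under the push map.\<close>

definition nonleast :: "nat set \<Rightarrow> nat set set \<Rightarrow> nat set set" where
  "nonleast G C = {U \<in> C. \<exists>V\<in>C. push G V = push G U \<and> gap G V < gap G U}"

text \<open>Let \<open>U\<close> and \<open>V\<close> be nonleast with the same gap \<open>y\<close>
  but different images, and let \<open>V'\<close> have the image of \<open>V\<close> and a smaller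
  gap \<open>v\<close>. For \<open>p < q\<close> in \<open>push G U - push G V\<close> and
  \<open>push G V - push G U\<close>, the labels \<open>v < y < p < q\<close> alternate between
  \<open>U\<close> and \<open>V'\<close>. If \<open>q < p\<close>, exchange \<open>U\<close> and
  \<open>V\<close>.\<close>

lemma gap_inj_on_nonleast:
  assumes G: "finite G" "C \<subseteq> {S. S \<subseteq> G \<and> card S = m}" "m < card G" and nc: "noncrossing C"
  shows "inj_on (gap G) (nonleast G C)"
proof -
  have key: False
    if U: "U \<in> C" "U' \<in> C" "push G U' = push G U" "gap G U' < gap G U"
      and V: "V \<in> C" "V' \<in> C" "push G V' = push G V" "gap G V' < gap G V"
      and eq: "gap G U = gap G V"
      and pq: "p \<in> push G U - push G V" "q \<in> push G V - push G U" "p < q" for U U' V V' p q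
  proof -
    define e y v Z Z' where d: "e = Min G" "y = gap G U" "v = gap G V'" "Z = push G U" "Z' = push G V"
    have sub: "S \<subseteq> G \<and> card S < card G" if "S \<in> C" for S using that G by blast
    have Ue: "U = insert e Z - {y}" using push_inverse[OF G(1), of U] sub U d by metis
    have Ve: "V' = insert e Z' - {v}" using push_inverse[OF G(1), of V'] sub V d by metis
    have vy: "v < y" using d V eq by simp
    have gU: "e \<le> v" using gap_props(4)[OF G(1), of V'] sub V d by blast
    have vG: "v \<in> G" "y \<in> G" using gap_props(1)[OF G(1)] sub V U d by blast+
    have inZ: "g \<in> Z" if "g \<in> G" "e < g" "g \<le> y" for g
      using push_below[OF G(1), of U g] sub[OF U(1)] that d by simp
    have inZ': "g \<in> Z'" if "g \<in> G" "e < g" "g \<le> y" for g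
      using push_below[OF G(1), of V g] sub[OF V(1)] that d eq by simp
    have eZ: "e \<notin> Z" "e \<notin> Z'" unfolding d push_def by auto
    have "p \<in> G - {e}" "q \<in> G - {e}"
      using pq(1,2) push_subset(1)[OF G(1), of U] push_subset(1)[OF G(1), of V] sub[OF U(1)] sub[OF V(1)]
      unfolding d by blast+
    hence pG: "p \<in> G" "q \<in> G" "e < p" "e < q"
      using Min_le[OF G(1)] unfolding d by (auto simp: order.strict_iff_order)
    have mem: "p \<in> Z" "p \<notin> Z'" "q \<in> Z'" "q \<notin> Z" using pq(1,2) unfolding d(4,5) by blast+
    hence py: "y < p" using inZ'[of p] pG(1,3) not_le by blast
    have "crosses U V'"
    proof (rule crossesI[of v U V' p y q])
      show "v \<in> U" using inZ[of v] vG vy gU Ue by (cases "v = e") auto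
      show "v \<notin> V'" "y \<notin> U" using Ve Ue by auto
      show "y \<in> V'" using inZ'[of y] vG vy gU Ve by auto
    qed (use Ue Ve mem pq(3) py vy pG(3,4) in auto)
    thus False using noncrossingD[OF nc U(1) V(2)] by simp
  qed
  show ?thesis
  proof (rule inj_onI)
    fix U V assume U: "U \<in> nonleast G C" and V: "V \<in> nonleast G C" and eq: "gap G U = gap G V"
    obtain U' V' where U': "U \<in> C" "U' \<in> C" "push G U' = push G U" "gap G U' < gap G U"
      and V': "V \<in> C" "V' \<in> C" "push G V' = push G V" "gap G V' < gap G V"
      using U V unfolding nonleast_def by blast
    have sub: "S \<subseteq> G \<and> card S = m \<and> card S < card G" if "S \<in> C" for S using that G by blast
    have "push G U = push G V"
    proof (rule ccontr)
      assume ne: "push G U \<noteq> push G V"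
      have fin: "finite (push G U)" "finite (push G V)"
        using push_subset(1)[OF G(1)] sub U' V' G(1) finite_subset by (metis finite_Diff)+
      have "card (push G U) = card (push G V)" using push_subset(2)[OF G(1)] sub U' V' by metis
      then obtain p q where pq: "p \<in> push G U - push G V" "q \<in> push G V - push G U"
        using ex_in_diff fin ne by metis
      show False
      proof (cases "p < q")
        case True thus False using key[OF U' V' eq pq] by blast
      next
        case False
        hence "q < p" using pq by (metis DiffD1 DiffD2 antisym_conv3)
        thus False using key[OF V' U' eq[symmetric] pq(2,1)] by blast
      qed
    qed
    thus "U = V" using push_inverse[OF G(1)] sub U' V' eq by metis
  qed
qed

text \<open>The labels above \<open>Min G\<close> up to the largest gap of a nonleast member all lie
  in its image, a set of size \<open>m\<close>; as the gaps are distinct, there are at most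
  \<open>m\<close> nonleast members. In case of equality the gaps fill an initial run of
  \<open>m\<close> labels, and no gap of any member can exceed it.\<close>

lemma card_nonleast:
  assumes G: "finite G" "C \<subseteq> {S. S \<subseteq> G \<and> card S = m}" "m < card G" and nc: "noncrossing C"
  shows "card (nonleast G C) \<le> m"
    and "card (nonleast G C) = m \<Longrightarrow> U \<in> C \<Longrightarrow> Min G < gap G U \<Longrightarrow> \<exists>V\<in>nonleast G C. gap G V = gap G U"
proof -
  define Y where "Y = gap G ` nonleast G C"
  have sub: "S \<subseteq> G \<and> card S = m \<and> card S < card G" if "S \<in> C" for S using that G by blast
  have finC: "finite C" using finite_family[OF G(1,2)] .
  have finY: "finite Y" unfolding Y_def nonleast_def using finC by simp
  have cY: "card (nonleast G C) = card Y" unfolding Y_def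
    using card_image[OF gap_inj_on_nonleast[OF assms]] by simp
  have Ym: "Min G < y \<and> y \<in> G" if yY: "y \<in> Y" for y
  proof -
    obtain U V where "U \<in> C" "y = gap G U" "V \<in> C" "gap G V < gap G U"
      using yY unfolding Y_def nonleast_def by auto
    moreover have "Min G \<le> gap G V" using gap_props(4) sub G(1) \<open>V \<in> C\<close> by blast
    ultimately show ?thesis using gap_props(1) sub G(1) by (metis le_less_trans)
  qed
  have below: "card {g \<in> G. Min G < g \<and> g \<le> gap G U} \<le> m" if "U \<in> C" for U
  proof -
    have "{g \<in> G. Min G < g \<and> g \<le> gap G U} \<subseteq> push G U"
      using push_below[OF G(1)] sub that by blast
    moreover have "finite (push G U)" using push_subset(1)[OF G(1)] sub that G(1)
      by (metis finite_subset finite_Diff)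
    ultimately show ?thesis using card_mono push_subset(2)[OF G(1)] sub that by metis
  qed
  have Ysub: "Y \<subseteq> {g \<in> G. Min G < g \<and> g \<le> Max Y}" using Ym finY by auto
  have cardmax: "card {g \<in> G. Min G < g \<and> g \<le> Max Y} \<le> m" if "Y \<noteq> {}"
  proof -
    have "Max Y \<in> Y" using finY that by simp
    then obtain U where "U \<in> C" "Max Y = gap G U" unfolding Y_def nonleast_def by blast
    thus ?thesis using below by simp
  qed
  have finI: "finite {g \<in> G. Min G < g \<and> g \<le> t}" for t using G(1) by simp
  show c1: "card (nonleast G C) \<le> m"
    using cardmax card_mono[OF finI Ysub] cY by (cases "Y = {}") auto
  assume eq: "card (nonleast G C) = m" and U: "U \<in> C" "Min G < gap G U"
  define y where "y = gap G U"
  have yG: "y \<in> G" using gap_props(1) sub G(1) U y_def by blast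
  have "y \<in> Y"
  proof (rule ccontr)
    assume yn: "y \<notin> Y"
    have sub2: "Y \<subseteq> {g \<in> G. Min G < g \<and> g \<le> y}"
    proof (cases "Y = {}")
      case False
      have "Y = {g \<in> G. Min G < g \<and> g \<le> Max Y}"
        using card_seteq[OF finI Ysub] cardmax[OF False] eq cY by simp
      hence "\<not> y \<le> Max Y" using yn yG U y_def by blast
      thus ?thesis using Ysub by auto
    qed simp
    have "y \<in> {g \<in> G. Min G < g \<and> g \<le> y}" using yG U y_def by simp
    hence "Y \<subset> {g \<in> G. Min G < g \<and> g \<le> y}" using sub2 yn by blast
    hence "card Y < card {g \<in> G. Min G < g \<and> g \<le> y}" using psubset_card_mono[OF finI] by blast
    thus False using below[OF U(1)] eq cY y_def by simp
  qed
  thus "\<exists>V\<in>nonleast G C. gap G V = gap G U" unfolding Y_def y_def by auto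
qed

text \<open>Outside the nonleast members each fibre keeps only its member of smallest gap, so the
  push map is injective there.\<close>

lemma card_le_card_push:
  assumes G: "finite G" "C \<subseteq> {S. S \<subseteq> G \<and> card S = m}" "m < card G" and nc: "noncrossing C"
  shows "card C \<le> card (push G ` C) + card (nonleast G C)"
proof -
  have sub: "S \<subseteq> G \<and> card S < card G" if "S \<in> C" for S using that G by blast
  have finC: "finite C" using finite_family[OF G(1,2)] .
  have "inj_on (push G) (C - nonleast G C)"
  proof (rule inj_onI)
    fix U V assume U: "U \<in> C - nonleast G C" and V: "V \<in> C - nonleast G C" and eq: "push G U = push G V"
    have "gap G U = gap G V" using U V eq unfolding nonleast_def by (metis (mono_tags, lifting) DiffE antisym_conv3 mem_Collect_eq)
    thus "U = V" using push_inverse[OF G(1)] sub U V eq by (metis DiffD1)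
  qed
  hence "card (C - nonleast G C) \<le> card (push G ` C)"
    using finC by (metis Diff_subset card_image card_mono finite_imageI image_mono)
  moreover have "C = (C - nonleast G C) \<union> nonleast G C" unfolding nonleast_def by blast
  hence "card C \<le> card (C - nonleast G C) + card (nonleast G C)" by (metis card_Un_le)
  ultimately show ?thesis by linarith
qed

lemma push_family:
  assumes G: "finite G" "C \<subseteq> {S. S \<subseteq> G \<and> card S = m}" "m < card G" and nc: "noncrossing C"
  shows "push G ` C \<subseteq> {S. S \<subseteq> G - {Min G} \<and> card S = m}" "noncrossing (push G ` C)"
proof -
  have sub: "S \<subseteq> G \<and> card S = m \<and> card S < card G" if "S \<in> C" for S using that G by blast
  show "push G ` C \<subseteq> {S. S \<subseteq> G - {Min G} \<and> card S = m}"
  proof clarify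
    fix U assume "U \<in> C"
    thus "push G U \<subseteq> G - {Min G} \<and> card (push G U) = m"
      using push_subset[OF G(1), of U] sub[of U] by simp
  qed
  show "noncrossing (push G ` C)"
    unfolding noncrossing_def
  proof clarify
    fix U V assume "U \<in> C" "V \<in> C" "crosses (push G U) (push G V)"
    thus False using crosses_push[OF G(1)] sub nc noncrossingD by meson
  qed
qed

theorem card_noncrossing_le:
  assumes "finite G" "C \<subseteq> {S. S \<subseteq> G \<and> card S = m}" "m \<le> card G" "noncrossing C"
  shows "card C \<le> m * (card G - m) + 1"
  using assms
proof (induction "card G" arbitrary: G C)
  case 0
  hence "C \<subseteq> {{}}" by auto
  thus ?case using card_mono[of "{{}}" C] by simp
next
  case (Suc k)
  show ?case
  proof (cases "m = card G")
    case True
    hence "C \<subseteq> {G}" using Suc.prems card_subset_eq by blast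
    thus ?thesis using card_mono[of "{G}" C] by simp
  next
    case False
    hence m: "m < card G" using Suc.prems by simp
    have "Min G \<in> G" using Suc.prems(1) m by (intro Min_in) auto
    hence c: "card (G - {Min G}) = k" using Suc.prems(1) Suc.hyps(2) by simp
    have "card (push G ` C) \<le> m * (card (G - {Min G}) - m) + 1"
      using Suc.hyps(1)[of "G - {Min G}" "push G ` C"] push_family[OF Suc.prems(1,2) m Suc.prems(4)]
        c m Suc.hyps(2) Suc.prems(1) by simp
    hence "card C \<le> m * (k - m) + 1 + m"
      using card_le_card_push[OF Suc.prems(1,2) m Suc.prems(4)]
        card_nonleast(1)[OF Suc.prems(1,2) m Suc.prems(4)] unfolding c by linarith
    moreover have "card G - m = Suc (k - m)" using m Suc.hyps(2) by simp
    ultimately show ?thesis by simp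
  qed
qed

section \<open>Collections attaining the size bound\<close>

definition full :: "nat set \<Rightarrow> nat \<Rightarrow> nat set set \<Rightarrow> bool" where
  "full G m C \<longleftrightarrow> finite G \<and> m \<le> card G \<and> C \<subseteq> {S. S \<subseteq> G \<and> card S = m} \<and> noncrossing C \<and>
     card C = m * (card G - m) + 1"

lemma fullD:
  assumes "full G m C"
  shows "finite G" "m \<le> card G" "noncrossing C" "card C = m * (card G - m) + 1" "finite C"
    "C \<subseteq> {S. S \<subseteq> G \<and> card S = m}"
    "\<And>S. S \<in> C \<Longrightarrow> S \<subseteq> G" "\<And>S. S \<in> C \<Longrightarrow> card S = m" "\<And>S. S \<in> C \<Longrightarrow> finite S"
    "\<And>S T. S \<in> C \<Longrightarrow> T \<in> C \<Longrightarrow> \<not> crosses S T"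
proof -
  show 1: "finite G" "m \<le> card G" "noncrossing C" "card C = m * (card G - m) + 1"
    "C \<subseteq> {S. S \<subseteq> G \<and> card S = m}" using assms unfolding full_def by auto
  show 2: "S \<subseteq> G" "card S = m" if "S \<in> C" for S using 1 that by auto
  show "finite S" if "S \<in> C" for S using 1 2[OF that] finite_subset by blast
  show "finite C" using 1(4) by (metis add_gr_0 card.infinite less_numeral_extra(1,3))
  show "\<not> crosses S T" if "S \<in> C" "T \<in> C" for S T using that 1(3) noncrossingD by blast
qed

text \<open>If \<open>S\<close> were missing, adding it would exceed the size bound. Later
  constructions use this to put a candidate into \<open>C\<close> by checking that no member crosses
  it.\<close>

lemma full_maximal:
  assumes C: "full G m C" and S: "S \<subseteq> G" "card S = m" and nc: "\<And>R. R \<in> C \<Longrightarrow> \<not> crosses R S"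
  shows "S \<in> C"
proof (rule ccontr)
  assume "S \<notin> C"
  note f = fullD[OF C]
  have "noncrossing (insert S C)"
    using f(3) nc crosses_sym unfolding noncrossing_def by (metis insert_iff not_crosses_refl)
  moreover have "insert S C \<subseteq> {S. S \<subseteq> G \<and> card S = m}" using f(6) S by blast
  ultimately have "card (insert S C) \<le> m * (card G - m) + 1"
    using card_noncrossing_le[of G "insert S C" m] f(1,2) by simp
  thus False using f(4,5) \<open>S \<notin> C\<close> by simp
qed

text \<open>The bounds for \<open>C\<close> and for its image differ by exactly \<open>m\<close>,
  the largest possible loss. Equality for \<open>C\<close> therefore forces equality for the image
  and exactly \<open>m\<close> nonleast members, the tight case of
  \<open>card_nonleast\<close>.\<close>

lemma full_push:
  assumes C: "full G m C" and m: "m < card G"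
  shows "full (G - {Min G}) m (push G ` C)"
    and "U \<in> C \<Longrightarrow> Min G < gap G U \<Longrightarrow> \<exists>V\<in>nonleast G C. gap G V = gap G U"
proof -
  note f = fullD[OF C]
  have "Min G \<in> G" using f(1) m by (intro Min_in) auto
  hence c: "card (G - {Min G}) = card G - 1" using f by simp
  have a: "card (push G ` C) \<le> m * (card G - 1 - m) + 1"
    using card_noncrossing_le[of "G - {Min G}" "push G ` C" m] push_family[OF f(1,6) m f(3)] f(1) m c
    by simp
  have e: "m * (card G - m) = m * (card G - 1 - m) + m"
  proof -
    have "card G - m = Suc (card G - 1 - m)" using m by simp
    thus ?thesis by simp
  qed
  have b: "card (nonleast G C) \<le> m" "card C \<le> card (push G ` C) + card (nonleast G C)"
    using card_nonleast(1)[OF f(1,6) m f(3)] card_le_card_push[OF f(1,6) m f(3)] by auto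
  have "card (push G ` C) = m * (card G - 1 - m) + 1" and eq: "card (nonleast G C) = m"
    using a b e f(4) by linarith+
  thus "full (G - {Min G}) m (push G ` C)"
    unfolding full_def using f(1) m c push_family[OF f(1,6) m f(3)] by simp
  show "\<exists>V\<in>nonleast G C. gap G V = gap G U" if "U \<in> C" "Min G < gap G U"
    using card_nonleast(2)[OF f(1,6) m f(3) eq that] .
qed

text \<open>When an edge \<open>W \<union> {p}\<close>, \<open>W \<union> {q}\<close> survives pushing \<open>e\<close> but its black third vertex does not lift, the
  fibre of \<open>W \<union> {q}\<close> splits at some \<open>z\<close>, and removing \<open>z\<close> gives a third vertex before pushing.\<close>

lemma replacement_not_crosses:
  fixes W R :: "nat set"
  assumes fin: "finite W" "finite R" and card: "card R = Suc (card W)"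
    and ord: "e < z" "z \<le> y" "y < w" "w < p" "p < q"
    and W: "z \<in> W" "y \<in> W" "w \<in> W" "e \<notin> W" "p \<notin> W" "q \<notin> W" "\<And>g. g \<in> W \<Longrightarrow> e < g"
    and R: "\<And>g. g \<in> R \<Longrightarrow> e \<le> g" "\<And>g. g \<in> R \<Longrightarrow> e < g \<Longrightarrow> g \<le> y \<Longrightarrow> g \<in> W"
    and nc: "\<not> crosses (insert p W) R" "\<not> crosses (insert q W) R"
      "\<not> crosses (insert e (insert q W) - {z}) R"
      "\<not> crosses (insert e (insert p (insert q W)) - {w, y}) R"
    and ne: "\<And>a. a \<in> W \<Longrightarrow> a < z \<Longrightarrow> R \<noteq> insert e (insert q W) - {a}"
  shows "\<not> crosses (insert p (insert q W) - {z}) R"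
proof
  define T where "T = insert p (insert q W) - {z}"
  define quad where "quad t t' r s \<longleftrightarrow> t \<in> T \<and> t \<notin> R \<and> t' \<in> T \<and> t' \<notin> R \<and>
    r \<in> R \<and> r \<notin> T \<and> s \<in> R \<and> s \<notin> T \<and> t < r \<and> r < t' \<and> (t' < s \<or> s < t)" for t t' r s
  assume "crosses (insert p (insert q W) - {z}) R"
  then obtain t0 t0' r0 s0 where quad0: "quad t0 t0' r0 s0"
    unfolding crosses_def quad_def T_def by blast
  have ncp: False if "a = p \<or> a \<in> W" "a \<notin> R" "c = p \<or> c \<in> W" "c \<notin> R" "b \<in> R" "b \<noteq> p" "b \<notin> W"
    "d \<in> R" "d \<noteq> p" "d \<notin> W" "a < b" "b < c" "c < d \<or> d < a" for a b c d
    using nc(1) crossesI[of a "insert p W" R c b d] that by blast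
  have ncq: False if "a = q \<or> a \<in> W" "a \<notin> R" "c = q \<or> c \<in> W" "c \<notin> R" "b \<in> R" "b \<noteq> q" "b \<notin> W"
    "d \<in> R" "d \<noteq> q" "d \<notin> W" "a < b" "b < c" "c < d \<or> d < a" for a b c d
    using nc(2) crossesI[of a "insert q W" R c b d] that by blast
  have nc1: False if "a = e \<or> a = q \<or> a \<in> W \<and> a \<noteq> z" "a \<notin> R" "c = e \<or> c = q \<or> c \<in> W \<and> c \<noteq> z" "c \<notin> R"
    "b \<in> R" "b \<noteq> e" "b \<noteq> q" "b \<notin> W \<or> b = z" "d \<in> R" "d \<noteq> e" "d \<noteq> q" "d \<notin> W \<or> d = z"
    "a < b" "b < c" "c < d \<or> d < a" for a b c d
  proof -
    have "z \<noteq> e" "z \<noteq> q" using ord by auto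
    thus False using nc(3) crossesI[of a "insert e (insert q W) - {z}" R c b d] that by blast
  qed
  have nc2: False if "a = e \<or> a = p \<or> a = q \<or> a \<in> W \<and> a \<noteq> w \<and> a \<noteq> y" "a \<notin> R"
    "c = e \<or> c = p \<or> c = q \<or> c \<in> W \<and> c \<noteq> w \<and> c \<noteq> y" "c \<notin> R"
    "b \<in> R" "b = y \<or> b \<notin> W \<and> b \<noteq> e \<and> b \<noteq> p \<and> b \<noteq> q"
    "d \<in> R" "d = y \<or> d \<notin> W \<and> d \<noteq> e \<and> d \<noteq> p \<and> d \<noteq> q"
    "a < b" "b < c" "c < d \<or> d < a" for a b c d
  proof -
    have "w \<noteq> e" "w \<noteq> p" "w \<noteq> q" "y \<noteq> e" "y \<noteq> p" "y \<noteq> q" using ord by auto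
    thus False
      using nc(4) crossesI[of a "insert e (insert p (insert q W)) - {w, y}" R c b d] that by blast
  qed
  have ord': "e < z" "z \<le> y" "y < w" "w < p" "p < q" "e < y" "e < w" "e < p" "e < q"
    "z < w" "z < p" "z < q" "y < p" "y < q" "w < q" using ord by auto
  note W' = W(1-6)
  have T: "x \<in> T \<longleftrightarrow> x = p \<or> x = q \<or> x \<in> W \<and> x \<noteq> z" for x using ord' unfolding T_def by auto
  \<comment> \<open>If \<open>z\<close> were missing from \<open>R\<close>, it could replace
    \<open>p\<close> or \<open>q\<close> in a crossing that uses both, which yields a crossing with
    \<open>insert q W\<close> or \<open>insert p W\<close>.\<close>
  have zR: "z \<in> R"
  proof (rule ccontr)
    assume zR: "z \<notin> R"
    have q: "t0 \<in> T" "t0 \<notin> R" "t0' \<in> T" "t0' \<notin> R" "r0 \<in> R" "r0 \<notin> T" "s0 \<in> R" "s0 \<notin> T" "t0 < r0"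
      "r0 < t0'" "t0' < s0 \<or> s0 < t0" using quad0 unfolding quad_def by auto
    have rs: "r0 \<notin> W" "r0 \<noteq> p" "r0 \<noteq> q" "s0 \<notin> W" "s0 \<noteq> p" "s0 \<noteq> q" "s0 \<noteq> z" using q zR T by auto
    consider "t0 \<noteq> q" "t0' \<noteq> q" | "t0 \<noteq> p" "t0' \<noteq> p" | "t0 = p" "t0' = q" using q ord' by fastforce
    thus False
    proof cases
      case 1 thus False using ncp[of t0 t0' r0 s0] q rs T by blast
    next
      case 2 thus False using ncq[of t0 t0' r0 s0] q rs T by blast
    next
      case 3
      have zr: "z < r0" "z < p" using ord' q 3 by auto
      consider "q < s0" | "s0 < z" | "z < s0" "s0 < p" using q 3 rs by fastforce
      thus False
      proof cases
        case 1 thus False using ncq[of z q r0 s0] zR zr q rs W' 3 by blast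
      next
        case 2 thus False using ncq[of z q r0 s0] zR zr q rs W' 3 by blast
      next
        case b: 3 thus False using ncp[of z p s0 r0] zR zr q rs W' 3 by blast
      qed
    qed
  qed
  have fW: "finite (insert p W)" "finite (insert q W)" "card (insert p W) = card R" "card (insert q W) = card R"
    using fin card W' by auto
  have cM: "card (insert e (insert q W) - {x}) = card R" if "x \<in> W" for x
  proof -
    have "e \<notin> insert q W" using W' ord' by auto
    thus ?thesis using fin card W' that by simp
  qed
  \<comment> \<open>The label \<open>e\<close> cannot be the fourth point of a crossing of
    \<open>T\<close> and \<open>R\<close>. This is where the minimality of \<open>z\<close>, in the
    form of \<open>ne\<close>, enters.\<close>
  have noeq: False if "quad t t' r e" for t t' r
  proof -
    have q: "t \<in> T" "t \<notin> R" "t' \<in> T" "t' \<notin> R" "r \<in> R" "r \<notin> T" "e \<in> R" "t < r" "r < t'" "e < t"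
      using that W(7) ord' unfolding quad_def T by auto
    consider "t < z" | "z < t" using q T ord' by fastforce
    thus False
    proof cases
      case 1
      have tW: "t \<in> W" using q T 1 ord' by auto
      have "\<not> t' < z"
      proof
        assume "t' < z"
        hence "r \<in> W" using R(2)[of r] q ord' by simp
        thus False using q T \<open>t' < z\<close> by auto
      qed
      hence zt': "z < t'" using q T ord' by fastforce
      \<comment> \<open>Otherwise \<open>t\<close> and \<open>u\<close> both lie in
        \<open>insert e (insert q W) - {z}\<close> but not in \<open>R\<close>. Counting gives a
        further point \<open>s\<close> of \<open>R\<close>, and on either side of \<open>u\<close>
        it produces a crossing.\<close>
      have top: "u = p" if uu: "u \<in> T" "u \<notin> R" "z < u" for u
      proof (rule ccontr)
        assume up: "u \<noteq> p"
        have "t \<in> insert e (insert q W) - {z} - R" "u \<in> insert e (insert q W) - {z} - R"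
          using tW 1 q uu T up by auto
        moreover have "card (insert e (insert q W) - {z}) = card R" using cM W(1) .
        ultimately obtain s where s: "s \<in> R" "s \<notin> insert e (insert q W) - {z}" "s \<noteq> z"
          using ex_other_in_diff[of "insert e (insert q W) - {z}" R t u z] fin 1 uu by fastforce
        have s': "s \<notin> W" "s \<noteq> q" "s \<noteq> e" using s by auto
        have es: "e < s" using R(1)[of s] s s' by (simp add: order.strict_iff_order)
        have "z < s" using R(2)[of s] s s' ord' es by fastforce
        show False
        proof (cases "s < u")
          case True
          thus False using ncq[of t u s e] tW q uu T up s s' W' \<open>z < s\<close> 1 ord' by auto
        next
          case False
          hence "u < s" using s uu by (metis antisym_conv3)
          thus False using nc1[of t u z s] tW 1 q uu T up s s' W' zR ord' by auto
        qed
      qed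
      have t'p: "t' = p" using top[of t'] q zt' by simp
      have yR: "y \<in> R" using top[of y] zR W' T ord' by fastforce
      have s: "s = q" if "s \<in> R" "s \<noteq> p" "s \<notin> W" "s \<noteq> e" for s
      proof (rule ccontr)
        assume "s \<noteq> q"
        have es: "e < s" using R(1)[of s] that by (simp add: order.strict_iff_order)
        have "y < s" using R(2)[of s] that es by fastforce
        hence "t < s" using 1 ord' by simp
        show False
        proof (cases "s < p")
          case True
          thus False using ncp[of t p s e] tW q t'p that W' \<open>t < s\<close> ord' by auto
        next
          case False
          hence "p < s" using that by simp
          thus False using nc2[of t p y s] tW q t'p that yR 1 ord' W' \<open>s \<noteq> q\<close> by auto
        qed
      qed
      \<comment> \<open>By counting, \<open>R\<close> is the set excluded by \<open>ne\<close>, with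
        removed label \<open>t < z\<close>.\<close>
      have "R \<subseteq> insert e (insert q W) - {t}" using s q t'p by auto
      moreover have "card (insert e (insert q W) - {t}) = card R" using cM tW .
      ultimately have "R = insert e (insert q W) - {t}" using fin by (simp add: card_subset_eq)
      thus False using ne[of t] tW 1 by simp
    next
      case 2
      have r: "r \<notin> W" "r \<noteq> p" "r \<noteq> q" using q T 2 by auto
      have "t = q \<or> t' = q" using ncp[of t t' r e] q r T W' ord' by auto
      moreover have "t = p \<or> t' = p" using ncq[of t t' r e] q r T W' ord' by auto
      ultimately have tt: "t = p" "t' = q" using q ord' by auto
      have er: "e \<noteq> r" using q by auto
      \<comment> \<open>Counting finds a point of \<open>W - R\<close>, which replaces
        \<open>p\<close> or \<open>q\<close> according to its side of \<open>r\<close>.\<close>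
      obtain u where u: "u \<in> insert p W" "u \<notin> R" "u \<noteq> p"
        using ex_other_in_diff[of R "insert p W" e r p] fin fW q(2,5,7) r W' ord' er by auto
      hence uW: "u \<in> W" by simp
      have eu: "e < u" using W(7) uW .
      show False
      proof (cases "u < r")
        case True
        thus False using ncq[of u q r e] uW u q r eu tt W' ord' by auto
      next
        case False
        hence "r < u" using u q by (metis antisym_conv3)
        thus False using ncp[of p u r e] uW u q r tt W' ord' by auto
      qed
    qed
  qed
  have eR: "e \<notin> R" if "quad t t' r s" "e < t" for t t' r s
  proof
    assume "e \<in> R"
    hence "quad t t' r e" using that W' ord' unfolding quad_def T by auto
    thus False using noeq by blast
  qed
  have eT: "e < t" if "t \<in> T" for t using that W(7) ord' unfolding T by auto
  have eR': "e \<notin> R" using eR[OF quad0] eT quad0 unfolding quad_def by blast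
  \<comment> \<open>Without \<open>p\<close> the quadruple would already cross
    \<open>insert e (insert q W) - {z}\<close>, as \<open>e\<close> is not in
    \<open>R\<close>.\<close>
  have hasp: "t = p \<or> t' = p" if "quad t t' r s" for t t' r s
    using nc1[of t t' r s] that eR' unfolding quad_def T by auto
  \<comment> \<open>Either \<open>e\<close> gives a crossing at once, or \<open>y\<close> does:
    inside \<open>R\<close> it stands in for \<open>z\<close>, against the set without
    \<open>w\<close> and \<open>y\<close>; outside \<open>R\<close> it yields a quadruple avoiding
    \<open>p\<close>, contrary to \<open>hasp\<close>.\<close>
  have main: False if qd: "quad t t' r s" and rz: "r = z \<or> s = z" for t t' r s
  proof -
    have q: "t \<in> T" "t \<notin> R" "t' \<in> T" "t' \<notin> R" "r \<in> R" "r \<notin> T" "s \<in> R" "s \<notin> T" "t < r" "r < t'"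
      "t' < s \<or> s < t" using qd unfolding quad_def by auto
    note pp = hasp[OF qd]
    have rp: "e \<noteq> r" "e \<noteq> s" using q eR' by auto
    consider (zin) "r = z" | (zout) "s = z" using rz by blast
    thus False
    proof cases
      case zin
      have t: "t < z" "t' = p" using q zin pp ord' by auto
      have tW: "t \<in> W" using q T t ord' by auto
      have sW: "s \<notin> W" "s \<noteq> p" "s \<noteq> q" 
      proof -
        have "s \<noteq> z" using q(9-11) zin by auto
        thus "s \<notin> W" "s \<noteq> p" "s \<noteq> q" using q(8) T[of s] by blast+
      qed
      have es: "e < s" using R(1)[OF q(7)] rp(2) by (simp add: order.strict_iff_order)
      have sy: "y < s" using R(2)[OF q(7) es] sW(1) by (meson not_le)
      have ps: "p < s" using q(11) t sy ord' by auto
      show False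
      proof (cases "y \<in> R")
        case True
        have "t \<noteq> w" "t \<noteq> y" "t < y" using t ord' by auto
        thus False using nc2[of t p y s] True t tW q(2,4,7) sW ps ord' rp by blast
      next
        case False
        moreover have "y \<noteq> z" using False zR by auto
        moreover have "z < y" using ord' \<open>y \<noteq> z\<close> by auto
        ultimately have "quad t y z s"
          using q(1,2,7,8) zR t(1) sy W' ord' unfolding quad_def T by blast
        thus False using hasp[of t y z s] t ord' by auto
      qed
    next
      case zout
      have zt: "z < t" using q zout pp ord' by auto
      have rW: "r \<notin> W" "r \<noteq> p" "r \<noteq> q"
      proof -
        have "r \<noteq> z" using q(9) zt by auto
        thus "r \<notin> W" "r \<noteq> p" "r \<noteq> q" using q(6) T[of r] by blast+
      qed
      show False
      proof (cases "t' = p")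
        case True
        have "t \<noteq> p" "t \<noteq> q" "t \<noteq> z" using True q(9,10) zt ord' by auto
        hence "t \<in> W" using q(1) T[of t] by blast
        moreover have "z \<noteq> e" "z \<noteq> q" using ord' by auto
        ultimately show False
          using nc1[of e t z r] eR' zR q(2,5,9) rW rp zt ord' \<open>t \<noteq> z\<close> by blast
      next
        case False
        hence tp: "t = p" using pp by simp
        show False
        proof (cases "y \<in> R")
          case True
          thus False using nc2[of e p y r] eR' q(2,5,9) rW rp tp ord' by blast
        next
          case False
          moreover have "y \<noteq> z" using False zR by auto
          moreover have "y < r" "z < y" using q(9) tp ord' \<open>y \<noteq> z\<close> by auto
          ultimately have "quad y t' r z" using q(3-6,10) zR W' ord' unfolding quad_def T by blast
          thus False using hasp[of y t' r z] \<open>t' \<noteq> p\<close> ord' by auto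
        qed
      qed
    qed
  qed
  have q: "t0 \<in> T" "t0 \<notin> R" "t0' \<in> T" "t0' \<notin> R" "r0 \<in> R" "r0 \<notin> T" "s0 \<in> R" "s0 \<notin> T" "t0 < r0"
    "r0 < t0'" "t0' < s0 \<or> s0 < t0" using quad0 unfolding quad_def by auto
  show False
  proof (cases "r0 = z \<or> s0 = z")
    case True thus False using main quad0 by blast
  next
    case False
    hence rs: "r0 \<notin> W" "r0 \<noteq> p" "r0 \<noteq> q" "s0 \<notin> W" "s0 \<noteq> p" "s0 \<noteq> q" using q T by auto
    have "t0 = q \<or> t0' = q" using ncp[of t0 t0' r0 s0] q rs T by blast
    hence "t0 = p" "t0' = q" using hasp[OF quad0] q ord' by auto
    \<comment> \<open>The fourth point may be exchanged for \<open>z\<close>, which lies in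
      \<open>R\<close> and below \<open>p\<close>.\<close>
    hence "quad p q r0 z" using q zR ord' unfolding quad_def T by auto
    thus False using main by blast
  qed
qed

section \<open>The third vertex lemma\<close>

definition cyc :: "nat \<Rightarrow> nat \<Rightarrow> nat \<Rightarrow> bool" where
  "cyc a b c \<longleftrightarrow> a < b \<and> b < c \<or> b < c \<and> c < a \<or> c < a \<and> a < b"

text \<open>In a plabic tiling the sets \<open>W \<union> {p}\<close> and \<open>W \<union> {q}\<close> span an edge. A third vertex of a tile on the
  side of the edge that belongs to the cyclic interval from \<open>p\<close> to \<open>q\<close> is either \<open>W \<union> {v}\<close> (white tile) or
  \<open>W \<union> {p, q} - {w}\<close> (black tile). \<open>inner_edge\<close> excludes the edges with nothing but the boundary on that
  side.\<close>

definition third :: "nat set set \<Rightarrow> nat set \<Rightarrow> nat \<Rightarrow> nat \<Rightarrow> bool" where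
  "third C W p q \<longleftrightarrow> (\<exists>v. v \<notin> W \<and> cyc p v q \<and> insert v W \<in> C) \<or>
     (\<exists>w\<in>W. cyc q w p \<and> insert p (insert q W) - {w} \<in> C)"

definition inner_edge :: "nat set \<Rightarrow> nat set \<Rightarrow> nat \<Rightarrow> nat \<Rightarrow> bool" where
  "inner_edge G W p q \<longleftrightarrow> (\<exists>v\<in>G - W. cyc p v q) \<or> (\<exists>w\<in>W. cyc q w p)"

definition edge :: "nat set \<Rightarrow> nat \<Rightarrow> nat set set \<Rightarrow> nat set \<Rightarrow> nat \<Rightarrow> nat \<Rightarrow> bool" where
  "edge G m C W p q \<longleftrightarrow> full G m C \<and> p \<noteq> q \<and> p \<notin> W \<and> q \<notin> W \<and> insert p W \<in> C \<and> insert q W \<in> C"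

lemma edgeD:
  assumes "edge G m C W p q"
  shows "full G m C" "p \<noteq> q" "p \<notin> W" "q \<notin> W" "insert p W \<in> C" "insert q W \<in> C"
    "p \<in> G" "q \<in> G" "W \<subseteq> G" "finite W" "Suc (card W) = m" "m < card G"
proof -
  show 1: "full G m C" "p \<noteq> q" "p \<notin> W" "q \<notin> W" "insert p W \<in> C" "insert q W \<in> C"
    using assms unfolding edge_def by auto
  note f = fullD[OF 1(1)]
  show 2: "p \<in> G" "q \<in> G" "W \<subseteq> G" using f(7)[OF 1(5)] f(7)[OF 1(6)] by auto
  show 3: "finite W" using f(9)[OF 1(5)] by simp
  show 4: "Suc (card W) = m" using f(8)[OF 1(5)] 1(3) 3 by simp
  have "card (insert q (insert p W)) \<le> card G" using 2 f(1) by (intro card_mono) auto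
  thus "m < card G" using 1 3 4 by simp
qed

section \<open>Lifting third vertices through the push map\<close>

lemma push_level:
  assumes C: "full G m C" "m < card G" and Z: "Z \<in> push G ` C"
  obtains U where "U \<in> C" "push G U = Z" "U = insert (Min G) Z - {gap G U}"
    "gap G U \<in> G" "Min G \<le> gap G U" "\<And>g. g \<in> G \<Longrightarrow> Min G < g \<Longrightarrow> g \<le> gap G U \<Longrightarrow> g \<in> Z"
    "Z \<subseteq> G - {Min G}"
proof -
  obtain U where U: "U \<in> C" "push G U = Z" using Z by blast
  have s: "finite G" "U \<subseteq> G" "card U < card G" using fullD(1,7,8)[OF C(1)] U C(2) by auto
  show ?thesis
    using that[OF U] push_inverse[OF s] gap_props(1,4)[OF s] push_below[OF s] push_subset(1)[OF s] U(2)
    by blast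
qed

text \<open>A white vertex, or a black one with \<open>q < w\<close>, lifts unchanged, since a gap
  above \<open>e\<close> would give a crossing; in the second case \<open>u\<close> bounds the gap.
  For \<open>w < p\<close> the black vertex found in \<open>C\<close> may omit a different element
  of \<open>W\<close>.\<close>

lemma third_step:
  assumes ed: "edge G m C W p q" and e: "e = Min G" "e \<notin> W" "e < p" "p < q"
    and u: "u \<in> G" "u \<notin> W" "u \<noteq> p" "e < u" "u < q"
    and IH: "third (push G ` C) W p q"
  shows "third C W p q"
proof -
  note E = edgeD[OF ed]
  note f = fullD[OF E(1)]
  have eG: "e \<le> g" if "g \<in> G" for g using that f(1) e(1) by simp
  have WG: "e < g" if "g \<in> W" for g
    using that eG[of g] E(9) e(2) by (metis le_neq_implies_less subsetD)
  have nc: False if "A \<in> C" "B \<in> C" "a \<in> A" "a \<notin> B" "b \<in> B" "b \<notin> A" "c \<in> A" "c \<notin> B" "d \<in> B" "d \<notin> A"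
    "a < b" "b < c" "c < d" for A B a b c d
    using f(10)[OF that(1,2)] crossesI[of a A B c b d] that by blast
  have e': "e \<notin> W" "e < p" "p < q" "e < q" using e(2-4) by auto
  consider (white) v where "v \<notin> W" "p < v" "v < q" "insert v W \<in> push G ` C"
    | (right) w where "w \<in> W" "q < w" "insert p (insert q W) - {w} \<in> push G ` C"
    | (left) w where "w \<in> W" "w < p" "insert p (insert q W) - {w} \<in> push G ` C"
    using IH e(4) unfolding third_def cyc_def by fastforce
  thus ?thesis
  proof cases
    case white
    obtain U where U: "U \<in> C" "U = insert e (insert v W) - {gap G U}" "gap G U \<in> G" "e \<le> gap G U"
      "\<And>g. g \<in> G \<Longrightarrow> e < g \<Longrightarrow> g \<le> gap G U \<Longrightarrow> g \<in> insert v W"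
      using push_level[OF E(1,12) white(4)] e(1) by metis
    define y where "y = gap G U"
    have "y = e"
    proof (rule ccontr)
      assume "y \<noteq> e"
      hence ey: "e < y" using U(4) y_def by simp
      have yp: "y < p" using U(5)[of p] E(3,7) e(3) white(2) y_def by (metis insertE less_irrefl not_le)
      have yW: "y \<in> W" using U(5)[of y] U(3) ey yp white(1-3) y_def by auto
      have Ue: "U = insert e (insert v W) - {y}" using U(2) y_def by simp
      show False
        by (rule nc[OF U(1) E(6), of e y v q]) (use Ue ey yp yW white(1-3) e' WG E(4) in auto)
    qed
    hence "insert v W = U" using U(2) e' white(1-3) y_def by auto
    thus ?thesis using U(1) white(1-3) unfolding third_def cyc_def by auto
  next
    case right
    define Z where "Z = insert p (insert q W) - {w}"
    obtain U where U: "U \<in> C" "U = insert e Z - {gap G U}" "gap G U \<in> G" "e \<le> gap G U"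
      "\<And>g. g \<in> G \<Longrightarrow> e < g \<Longrightarrow> g \<le> gap G U \<Longrightarrow> g \<in> Z"
      using push_level[OF E(1,12) right(3)] e(1) Z_def by metis
    define y where "y = gap G U"
    have "y = e"
    proof (rule ccontr)
      assume "y \<noteq> e"
      hence ey: "e < y" using U(4) y_def by simp
      have "u \<notin> Z" using u unfolding Z_def by auto
      hence yu: "y < u" using U(5)[of u] u y_def by (meson not_le)
      have yW: "y \<in> insert p W" using U(5)[of y] U(3) ey yu u(5) y_def unfolding Z_def by auto
      have Ue: "U = insert e Z - {y}" using U(2) y_def by simp
      have yw: "y \<noteq> w" "y \<noteq> q" using yu u right(1,2) by auto
      show False
        by (rule nc[OF U(1) E(5), of e y q w]) (use Ue ey yu yW yw right(1,2) e' u E(2,3,4) Z_def in auto)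
    qed
    hence "Z = U" using U(2) e' y_def unfolding Z_def by auto
    thus ?thesis using U(1) right(1,2) e' unfolding third_def cyc_def Z_def by auto
  next
    case left
    \<comment> \<open>Take the largest \<open>w\<close> possible and, in its fibre, the member
      \<open>U0\<close> of smallest gap. Both extremal choices serve to identify the set
      \<open>V\<close> below.\<close>
    define L where "L = {w \<in> W. w < p \<and> insert p (insert q W) - {w} \<in> push G ` C}"
    have L: "finite L" "L \<noteq> {}" using left E(10) unfolding L_def by auto
    define w where "w = Max L"
    have w: "w \<in> W" "w < p" "insert p (insert q W) - {w} \<in> push G ` C"
      using Max_in[OF L] unfolding w_def L_def by auto
    have wmax: "w' \<le> w" if "w' \<in> L" for w' using that L unfolding w_def by simp
    define Z where "Z = insert p (insert q W) - {w}"
    define F where "F = {U \<in> C. push G U = Z}"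
    have "finite F" "F \<noteq> {}" using f(5) w(3) unfolding F_def Z_def by auto
    then obtain U0 where U0: "U0 \<in> F" "\<And>U. U \<in> F \<Longrightarrow> gap G U0 \<le> gap G U"
      using arg_min_if_finite[of F "gap G"] by (metis not_le)
    define y where "y = gap G U0"
    have sub: "finite G" "U \<subseteq> G" "card U < card G" if "U \<in> C" for U using f(1,7,8) that E(12) by auto
    have UC: "U0 \<in> C" "push G U0 = Z" using U0 unfolding F_def by auto
    have Ue: "U0 = insert e Z - {y}" using push_inverse[OF sub[OF UC(1)]] UC e y_def by simp
    have yG: "y \<in> G" "e \<le> y" using gap_props(1,4)[OF sub[OF UC(1)]] e y_def by auto
    have run: "g \<in> Z" if "g \<in> G" "e < g" "g \<le> y" for g
      using push_below[OF sub[OF UC(1)]] that UC e y_def by auto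
    show ?thesis
    proof (cases "y = e")
      case True
      hence "Z \<in> C" using Ue UC(1) e' by (auto simp: Z_def)
      thus ?thesis using w e(4) unfolding third_def cyc_def Z_def by blast
    next
      case False
      hence ey: "e < y" using yG by simp
      have ew: "e < w" using WG w by simp
      have yw: "y < w" using run[of w] w E(9) ew unfolding Z_def by (metis DiffD2 insertI1 not_le subsetD)
      have runW: "g \<in> W" if "g \<in> G" "e < g" "g \<le> y" for g
        using run[OF that] that(3) yw w(2) e(4) unfolding Z_def by auto
      have yW: "y \<in> W" using runW[OF yG(1) ey] by simp
      \<comment> \<open>Tightness: the gap \<open>y\<close> also occurs at a member
        \<open>V0\<close> that is not least in its fibre.\<close>
      obtain V0 V1 where V: "V0 \<in> C" "V1 \<in> C" "push G V1 = push G V0" "gap G V1 < gap G V0" "gap G V0 = y"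
        using full_push(2)[OF E(1,12) UC(1)] ey e y_def unfolding nonleast_def by auto
      define V y' where "V = push G V0" and "y' = gap G V1"
      have y'y: "y' < y" using V y'_def by simp
      have V0e: "V0 = insert e V - {y}" using push_inverse[OF sub[OF V(1)]] V e V_def by simp
      have V1e: "V1 = insert e V - {y'}" using push_inverse[OF sub[OF V(2)]] V e V_def y'_def by simp
      have y'G: "y' \<in> G" "e \<le> y'" using gap_props(1,4)[OF sub[OF V(2)]] e y'_def by auto
      have runV: "g \<in> V" if "g \<in> G" "e < g" "g \<le> y" for g
        using push_below[OF sub[OF V(1)]] that V e V_def by auto
      have VG: "V \<subseteq> G - {e}" "card V = m"
        using push_subset[OF sub[OF V(1)]] V_def e f(8)[OF V(1)] by auto
      have VC: "V \<in> push G ` C" using V V_def by blast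
      have VZ: "V \<noteq> Z"
      proof
        assume "V = Z"
        hence "V1 \<in> F" using V V_def unfolding F_def by auto
        thus False using U0(2) y'y y'_def y_def by fastforce
      qed
      have finV: "finite V" using VG f(1) finite_subset by blast
      have ZG: "Z \<subseteq> G - {e}" using push_subset(1)[OF sub[OF UC(1)]] UC e by simp
      have gt: "y < x" if "x \<in> G" "x \<noteq> e" "x \<notin> V \<or> x \<notin> Z \<or> x \<notin> W" for x
        using run[of x] runV[of x] runW[of x] eG[of x] that by (metis le_neq_implies_less not_le)
      \<comment> \<open>Otherwise \<open>y' < y < b < a\<close> would alternate between
        \<open>U0\<close> and \<open>V1\<close>.\<close>
      have o1: "a < b" if ab: "a \<in> V - Z" "b \<in> Z - V" for a b
      proof (rule ccontr)
        assume "\<not> a < b"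
        hence ba: "b < a" using ab by (metis DiffD1 DiffD2 antisym_conv3)
        have yb: "y < b" using gt[of b] ab ZG by blast
        have "y' \<in> U0" using y'y y'G run[of y'] Ue by (cases "y' = e") auto
        moreover have "y \<in> V1" using runV[of y] yG ey y'y V1e by auto
        ultimately show False
          by (intro nc[OF UC(1) V(2), of y' y b a]) (use Ue V1e y'y yb ba ab ZG VG ey in auto)
      qed
      \<comment> \<open>Otherwise \<open>e < y < b < a\<close> would alternate between
        \<open>V0\<close> and \<open>insert t W\<close>.\<close>
      have o2: "a < b" if ab: "a \<in> insert t W - V" "b \<in> V - insert t W" and tC: "insert t W \<in> C" "e < t" for a b t
      proof (rule ccontr)
        assume "\<not> a < b"
        hence ba: "b < a" using ab by (metis DiffD1 DiffD2 antisym_conv3)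
        have yb: "y < b" using gt[of b] ab VG by blast
        show False
          by (rule nc[OF V(1) tC(1), of e y b a]) (use V0e yW yb ba ab VG ey tC(2) e'(1) in auto)
      qed
      note epq = e'(2,4)
      \<comment> \<open>For \<open>insert p W\<close> there is a crossing; a label outside
        \<open>W\<close>, \<open>p\<close> and \<open>q\<close> contradicts \<open>o1\<close> and
        \<open>o2\<close> together; another black vertex would omit some \<open>w' > w\<close>,
        against the choice of \<open>w\<close>.\<close>
      have "V = insert q W"
      proof (rule ccontr)
        assume Vq: "V \<noteq> insert q W"
        show False
        proof (cases "V = insert p W")
          case True
          show False
            by (rule nc[OF V(1) E(6), of e y p q])
              (use V0e True yW ey yw w(1,2) e' E(2,3,4) in auto)
        next
          case Vp: False
          have Vsub: "V \<subseteq> insert p (insert q W)"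
          proof
            fix x assume x: "x \<in> V"
            show "x \<in> insert p (insert q W)"
            proof (rule ccontr)
              assume xn: "x \<notin> insert p (insert q W)"
              have finZ: "finite Z" using E(10) unfolding Z_def by simp
              have "card Z = card V" using push_subset(2)[OF sub[OF UC(1)]] UC f(8) VG by simp
              then obtain z where z: "z \<in> Z - V" using ex_in_diff[OF finZ finV] VZ by metis
              have "x < z" using o1[of x z] x xn z unfolding Z_def by auto
              moreover have "z < x"
              proof (cases "z = q")
                case True
                thus ?thesis using o2[of z q x] z x xn E(6) epq by auto
              next
                case False
                thus ?thesis using o2[of z p x] z x xn E(5) epq unfolding Z_def by auto
              qed
              ultimately show False by simp
            qed
          qed
          have "card (insert p (insert q W) - V) = 1"
            using card_Diff_subset[OF finV Vsub] E VG by simp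
          then obtain w' where w'0: "insert p (insert q W) - V = {w'}" by (rule card_1_singletonE)
          hence w': "V = insert p (insert q W) - {w'}" "w' \<in> insert p (insert q W)"
            using Vsub by blast+
          have w'pq: "w' \<noteq> p" "w' \<noteq> q" using w' Vp Vq E by auto
          hence w'W: "w' \<in> W" "w' \<noteq> w" using w' VZ unfolding Z_def by auto
          have "w < w'" using o1[of w w'] w w' w'W w'pq E unfolding Z_def by auto
          moreover have "w' < p" using o2[of w' q p] w' w'W w'pq E epq e(4) by auto
          hence "w' \<in> L" using w' w'W VC unfolding L_def by simp
          ultimately show False using wmax by fastforce
        qed
      qed
      hence Vy: "insert e (insert q W) - {y} \<in> C" using V0e V(1) by simp
      \<comment> \<open>Leastness of \<open>z\<close> provides the hypothesis \<open>ne\<close> of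
        \<open>replacement_not_crosses\<close>.\<close>
      define z where "z = (LEAST a. a \<in> W \<and> insert e (insert q W) - {a} \<in> C)"
      have z: "z \<in> W" "insert e (insert q W) - {z} \<in> C" "z \<le> y"
        using LeastI[of "\<lambda>a. a \<in> W \<and> insert e (insert q W) - {a} \<in> C" y]
          Least_le[of "\<lambda>a. a \<in> W \<and> insert e (insert q W) - {a} \<in> C" y] Vy yW unfolding z_def by auto
      have zl: "insert e (insert q W) - {a} \<notin> C" if "a \<in> W" "a < z" for a
        using not_less_Least[of a "\<lambda>a. a \<in> W \<and> insert e (insert q W) - {a} \<in> C"] that
        unfolding z_def by blast
      have "insert p (insert q W) - {z} \<in> C"
      proof (rule full_maximal[OF E(1)])
        show "insert p (insert q W) - {z} \<subseteq> G" using E by auto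
        show "card (insert p (insert q W) - {z}) = m" using E z by simp
        fix R assume R: "R \<in> C"
        have Z': "insert e (insert p (insert q W)) - {w, y} = U0"
          using Ue ew unfolding Z_def by auto
        have "\<not> crosses (insert p (insert q W) - {z}) R"
        proof (rule replacement_not_crosses[of W R e z y w p q])
          show "finite W" "finite R" "card R = Suc (card W)" using E f(8,9) R by auto
          show "e < z" using WG z by simp
          show "e \<le> g" if "g \<in> R" for g using eG f(7)[OF R] that by blast
          show "g \<in> W" if "g \<in> R" "e < g" "g \<le> y" for g using runW f(7)[OF R] that by blast
          show "\<not> crosses (insert e (insert p (insert q W)) - {w, y}) R"
            using f(10)[OF UC(1) R] Z' by simp
          show "R \<noteq> insert e (insert q W) - {a}" if "a \<in> W" "a < z" for a using zl that R by auto
        qed (use z yw w(1,2) e' E(3-6) f(10)[OF _ R] yW WG in auto)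
        thus "\<not> crosses R (insert p (insert q W) - {z})" using crosses_sym by blast
      qed
      moreover have "cyc q z p" using z yw w(1,2) e' unfolding cyc_def by auto
      ultimately show ?thesis using z(1) unfolding third_def by blast
    qed
  qed
qed

text \<open>If a white vertex does not lift unchanged, its gap can only be \<open>e'\<close>. Then
  \<open>v = e'\<close>, and the preimage is \<open>insert e W\<close>, again a white vertex because
  \<open>e\<close> lies on the same arc. A black vertex lifts because \<open>e'\<close> is missing
  from it.\<close>

lemma third_step_adjacent:
  assumes ed: "edge G m C W p q" and e: "e = Min G" "e \<notin> W" "e' \<notin> W" "e' \<in> G" "e < e'" "e' < q" "q < p"
    and cons: "\<And>g. g \<in> G \<Longrightarrow> g \<le> q \<Longrightarrow> g = e \<or> g = e' \<or> g = q"
    and IH: "third (push G ` C) W p q"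
  shows "third C W p q"
proof -
  note E = edgeD[OF ed]
  note f = fullD[OF E(1)]
  show ?thesis using IH unfolding third_def[of "push G ` C"]
  proof (elim disjE exE bexE conjE)
    fix v assume v: "v \<notin> W" "cyc p v q" "insert v W \<in> push G ` C"
    obtain U where U: "U \<in> C" "U = insert e (insert v W) - {gap G U}" "gap G U \<in> G" "e \<le> gap G U"
      "\<And>g. g \<in> G \<Longrightarrow> e < g \<Longrightarrow> g \<le> gap G U \<Longrightarrow> g \<in> insert v W" "insert v W \<subseteq> G - {e}"
      using push_level[OF E(1,12) v(3)] e(1) by metis
    define y where "y = gap G U"
    have Ue: "U = insert e (insert v W) - {y}" using U(2) y_def by simp
    have vq: "v \<noteq> q" using v(2) unfolding cyc_def by auto
    show ?thesis
    proof (cases "y = e")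
      case True
      hence "insert v W = U" using Ue e(2) U(6) by auto
      thus ?thesis using U(1) v(1,2) unfolding third_def by blast
    next
      case False
      hence ey: "e < y" using U(4) y_def by simp
      have "y < q" using U(5)[of q] E(4,8) e vq y_def by (metis insertE not_le order.strict_trans)
      hence ye': "y = e'" using cons[of y] U(3) ey y_def by auto
      hence "v = e'" using U(5)[of e'] e y_def by auto
      hence "insert e W \<in> C" using Ue ye' U(1) e by (metis Diff_insert_absorb insert_commute insert_iff less_irrefl)
      moreover have "cyc p e q" using e unfolding cyc_def by auto
      ultimately show ?thesis using e(2) unfolding third_def by blast
    qed
  next
    fix w assume w: "w \<in> W" "cyc q w p" "insert p (insert q W) - {w} \<in> push G ` C"
    define Z where "Z = insert p (insert q W) - {w}"
    obtain U where U: "U \<in> C" "U = insert e Z - {gap G U}" "gap G U \<in> G" "e \<le> gap G U"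
      "\<And>g. g \<in> G \<Longrightarrow> e < g \<Longrightarrow> g \<le> gap G U \<Longrightarrow> g \<in> Z" "Z \<subseteq> G - {e}"
      using push_level[OF E(1,12) w(3)] e(1) Z_def by metis
    have "e' \<notin> Z" using e unfolding Z_def by auto
    hence "gap G U < e'" using U(5)[of e'] e by (meson not_le)
    hence "gap G U = e" using cons[of "gap G U"] U(3) e by auto
    hence "Z = U" using U(2,6) by auto
    thus ?thesis using U(1) w(1,2) unfolding third_def Z_def by blast
  qed
qed

text \<open>Removing a cyclic neighbour \<open>x\<close> of \<open>e\<close> from
  \<open>insert p (insert q W)\<close> gives a set that nothing crosses, since its two missing
  labels are adjacent on the circle. If the least label above \<open>e\<close> is not in
  \<open>W\<close>, it is \<open>p\<close>, and the greatest label serves as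
  \<open>x\<close>.\<close>

lemma third_single_gap:
  assumes ed: "edge G m C W p q" and e: "e = Min G" "e \<notin> W" "e < p" "p < q" "G = insert e (insert p (insert q W))"
    and w: "w \<in> W" "w < p \<or> q < w"
  shows "third C W p q"
proof -
  note E = edgeD[OF ed]
  note f = fullD[OF E(1)]
  have WG: "e < g" if "g \<in> W" for g
    using that Min_le[OF f(1), of g] E(9) e(1,2) by (metis le_neq_implies_less subsetD)
  have Gm: "g = e \<or> g = p \<or> g = q \<or> g \<in> W" if "g \<in> G" for g
    using that unfolding e(5) by blast
  note e' = e(2-4)
  have mem: "insert p (insert q W) - {x} \<in> C"
    if x: "x \<in> W" and ext: "(\<forall>g\<in>G. e < g \<longrightarrow> x \<le> g) \<or> (\<forall>g\<in>G. g \<le> x)" for x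
  proof (rule full_maximal[OF E(1)])
    show "insert p (insert q W) - {x} \<subseteq> G" using E by auto
    show "card (insert p (insert q W) - {x}) = m" using E x by simp
    fix R assume R: "R \<in> C"
    show "\<not> crosses R (insert p (insert q W) - {x})"
    proof
      assume "crosses R (insert p (insert q W) - {x})"
      then obtain a b c d where q: "a \<in> R - (insert p (insert q W) - {x})" "c \<in> R - (insert p (insert q W) - {x})"
        "b \<in> insert p (insert q W) - {x}" "d \<in> insert p (insert q W) - {x}" "a < b" "b < c" "c < d \<or> d < a"
        unfolding crosses_def by blast
      have RG: "R \<subseteq> G" using f(7) R by blast
      have "a = e \<or> a = x" "c = e \<or> c = x" using q(1,2) RG Gm[of a] Gm[of c] by blast+
      hence ac: "a = e" "c = x" using q(5,6) WG[OF x] by (metis less_asym less_trans)+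
      have bG: "b \<in> G" "b \<noteq> e" "d \<in> G" "d \<noteq> x" using q(3,4) E(7-9) e' by auto
      have "e < b" "e \<le> d" using bG Min_le[OF f(1)] e(1) by (auto simp: order.strict_iff_order)
      thus False using ext bG q(5-7) ac by (metis not_le)
    qed
  qed
  show ?thesis
  proof (cases "\<exists>x\<in>W. \<forall>g\<in>G. e < g \<longrightarrow> x \<le> g")
    case True
    then obtain x where x: "x \<in> W" "\<forall>g\<in>G. e < g \<longrightarrow> x \<le> g" by blast
    have "x \<le> p" "x \<noteq> p" using x E(3,7) e' by auto
    hence "cyc q x p" using e' unfolding cyc_def by auto
    thus ?thesis using mem[of x] x unfolding third_def by blast
  next
    case False
    have Wp: "p < g" if "g \<in> W" for g
    proof (rule ccontr)
      assume "\<not> p < g"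
      hence gp: "g < p" using that E(3) by (metis antisym_conv3)
      define x where "x = Min W"
      have x: "x \<in> W" "\<And>h. h \<in> W \<Longrightarrow> x \<le> h" using Min_in[OF E(10)] Min_le[OF E(10)] that unfolding x_def by blast+
      have "\<forall>h\<in>G. e < h \<longrightarrow> x \<le> h"
      proof (intro ballI impI)
        fix h assume "h \<in> G" "e < h"
        thus "x \<le> h" using Gm[of h] x(2) x(2)[OF that] gp e' by fastforce
      qed
      thus False using False x by blast
    qed
    define x where "x = Max W"
    have x: "x \<in> W" "\<And>h. h \<in> W \<Longrightarrow> h \<le> x" using Max_in[OF E(10)] Max_ge[OF E(10)] w(1) unfolding x_def by blast+
    have "q < w" using w Wp[of w] by auto
    hence qx: "q < x" using x(2)[OF w(1)] by simp
    have "\<forall>g\<in>G. g \<le> x"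
    proof
      fix g assume "g \<in> G"
      thus "g \<le> x" using Gm[of g] x qx e' by fastforce
    qed
    hence "insert p (insert q W) - {x} \<in> C" using mem x by blast
    moreover have "cyc q x p" using qx e' unfolding cyc_def by auto
    ultimately show ?thesis using x unfolding third_def by blast
  qed
qed

section \<open>Rotation and complementation of the labels\<close>

lemma crosses_cyc:
  "crosses A B \<longleftrightarrow> (\<exists>a\<in>A - B. \<exists>b\<in>B - A. \<exists>c\<in>A - B. \<exists>d\<in>B - A. cyc a b c \<and> cyc c d a)"
proof
  assume "crosses A B"
  then obtain a b c d where abcd: "a \<in> A - B" "c \<in> A - B" "b \<in> B - A" "d \<in> B - A"
    "a < b" "b < c" "c < d \<or> d < a" unfolding crosses_def by blast
  hence "cyc a b c" "cyc c d a" unfolding cyc_def by auto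
  thus "\<exists>a\<in>A - B. \<exists>b\<in>B - A. \<exists>c\<in>A - B. \<exists>d\<in>B - A. cyc a b c \<and> cyc c d a"
    using abcd by blast
next
  assume "\<exists>a\<in>A - B. \<exists>b\<in>B - A. \<exists>c\<in>A - B. \<exists>d\<in>B - A. cyc a b c \<and> cyc c d a"
  then obtain a b c d where abcd: "a \<in> A - B" "b \<in> B - A" "c \<in> A - B" "d \<in> B - A" "cyc a b c" "cyc c d a"
    by blast
  show "crosses A B"
  proof (cases "a < c")
    case True
    hence "a < b" "b < c" "c < d \<or> d < a" using abcd(5,6) unfolding cyc_def by auto
    thus ?thesis using abcd unfolding crosses_def by blast
  next
    case False
    hence "c < d" "d < a" "a < b \<or> b < c" using abcd(5,6) unfolding cyc_def by auto
    thus ?thesis using abcd unfolding crosses_def by blast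
  qed
qed

text \<open>Crossing depends only on the cyclic order, so such a map transports full collections,
  edges and third vertices.\<close>

definition cyc_iso :: "nat set \<Rightarrow> (nat \<Rightarrow> nat) \<Rightarrow> bool" where
  "cyc_iso G f \<longleftrightarrow> inj_on f G \<and> (\<forall>a\<in>G. \<forall>b\<in>G. \<forall>c\<in>G. cyc (f a) (f b) (f c) \<longleftrightarrow> cyc a b c)"

lemma crosses_cyc_iso:
  assumes f: "cyc_iso G f" and AB: "A \<subseteq> G" "B \<subseteq> G" "crosses (f ` A) (f ` B)"
  shows "crosses A B"
proof -
  have inj: "inj_on f G" using f unfolding cyc_iso_def by blast
  have d: "f ` A - f ` B = f ` (A - B)" "f ` B - f ` A = f ` (B - A)"
    using inj_on_image_set_diff[OF inj] AB by (metis Diff_subset subset_trans)+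
  obtain a b c x where q: "a \<in> A - B" "b \<in> B - A" "c \<in> A - B" "x \<in> B - A"
    "cyc (f a) (f b) (f c)" "cyc (f c) (f x) (f a)"
    using AB(3) unfolding crosses_cyc d by blast
  have "cyc a b c" "cyc c x a" using q f AB unfolding cyc_iso_def by blast+
  thus ?thesis using q unfolding crosses_cyc by blast
qed

lemma full_cyc_iso:
  assumes f: "cyc_iso G f" and C: "full G m C"
  shows "full (f ` G) m ((`) f ` C)"
proof -
  have inj: "inj_on f G" using f unfolding cyc_iso_def by blast
  note F = fullD[OF C]
  have inj2: "inj_on ((`) f) C"
    using inj_on_image_Pow[OF inj] F(7) by (meson PowI inj_on_subset subsetI)
  have "noncrossing ((`) f ` C)"
    unfolding noncrossing_def
  proof clarify
    fix A B assume "A \<in> C" "B \<in> C" "crosses (f ` A) (f ` B)"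
    thus False using crosses_cyc_iso[OF f F(7) F(7)] F(10) by blast
  qed
  moreover have "(`) f ` C \<subseteq> {S. S \<subseteq> f ` G \<and> card S = m}"
  proof clarify
    fix S assume S: "S \<in> C"
    have "card (f ` S) = m" using card_image[OF inj_on_subset[OF inj F(7)[OF S]]] F(8)[OF S] by simp
    thus "f ` S \<subseteq> f ` G \<and> card (f ` S) = m" using F(7)[OF S] by blast
  qed
  ultimately show ?thesis
    unfolding full_def using F(1,2,4) card_image[OF inj] card_image[OF inj2] by simp
qed

lemma edge_cyc_iso:
  assumes f: "cyc_iso G f" and ed: "edge G m C W p q"
  shows "edge (f ` G) m ((`) f ` C) (f ` W) (f p) (f q)"
proof -
  have inj: "inj_on f G" using f unfolding cyc_iso_def by blast
  note E = edgeD[OF ed]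
  have n: "f x \<notin> f ` W" if "x \<in> G" "x \<notin> W" for x
    using that inj E(9) by (meson inj_on_image_mem_iff)
  have "f p \<noteq> f q" using inj E by (metis inj_onD)
  moreover have "insert (f x) (f ` W) \<in> (`) f ` C" if "insert x W \<in> C" for x
    using that by (metis image_eqI image_insert)
  ultimately show ?thesis unfolding edge_def using full_cyc_iso[OF f E(1)] n E by blast
qed

lemma third_cyc_iso:
  assumes f: "cyc_iso G f" and ed: "edge G m C W p q" and th: "third ((`) f ` C) (f ` W) (f p) (f q)"
  shows "third C W p q"
proof -
  have inj: "inj_on f G" using f unfolding cyc_iso_def by blast
  note E = edgeD[OF ed]
  note F = fullD[OF E(1)]
  have mem_C: "S \<in> C" if "f ` S \<in> (`) f ` C" "S \<subseteq> G" for S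
    using that F(7) inj by (metis imageE inj_on_image_eq_iff)
  from th show ?thesis unfolding third_def[of "(`) f ` C"]
  proof (elim disjE exE bexE conjE)
    fix v assume v: "v \<notin> f ` W" "cyc (f p) v (f q)" "insert v (f ` W) \<in> (`) f ` C"
    then obtain S where S: "S \<in> C" "insert v (f ` W) = f ` S" by blast
    then obtain x where x: "x \<in> S" "v = f x" by blast
    have xG: "x \<in> G" using x S F(7) by blast
    have "f ` (insert x W) \<in> (`) f ` C" using v(3) x by simp
    hence "insert x W \<in> C" using mem_C[of "insert x W"] xG E(9) by blast
    moreover have "cyc p x q" using f v(2) x xG E(7,8) unfolding cyc_iso_def by blast
    ultimately show ?thesis using v x unfolding third_def by blast
  next
    fix w assume w: "w \<in> f ` W" "cyc (f q) w (f p)" "insert (f p) (insert (f q) (f ` W)) - {w} \<in> (`) f ` C"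
    then obtain x where x: "x \<in> W" "w = f x" by blast
    have sub: "insert p (insert q W) \<subseteq> G" "{x} \<subseteq> G" using E(7-9) x by auto
    have "f ` (insert p (insert q W) - {x}) = f ` (insert p (insert q W)) - f ` {x}"
      using inj_on_image_set_diff[OF inj, of "insert p (insert q W)" "{x}"] sub by blast
    hence "f ` (insert p (insert q W) - {x}) \<in> (`) f ` C" using w(3) x(2) by simp
    hence "insert p (insert q W) - {x} \<in> C" using mem_C sub(1) by blast
    moreover have "cyc q x p" using f w(2) x E(7-9) unfolding cyc_iso_def by blast
    ultimately show ?thesis using x unfolding third_def by blast
  qed
qed

lemma inner_edge_cyc_iso:
  assumes f: "cyc_iso G f" and G: "W \<subseteq> G'" "G' \<subseteq> G" "p \<in> G" "q \<in> G" and i: "inner_edge G' W p q"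
  shows "inner_edge (f ` G') (f ` W) (f p) (f q)"
proof -
  have inj: "inj_on f G" using f unfolding cyc_iso_def by blast
  from i show ?thesis unfolding inner_edge_def[of G']
  proof (elim disjE bexE)
    fix v assume v: "v \<in> G' - W" "cyc p v q"
    hence "f v \<in> f ` G' - f ` W" using inj G by (simp add: inj_on_image_mem_iff subset_iff)
    moreover have "cyc (f p) (f v) (f q)" using f v G unfolding cyc_iso_def by blast
    ultimately show ?thesis unfolding inner_edge_def by blast
  next
    fix w assume w: "w \<in> W" "cyc q w p"
    hence "cyc (f q) (f w) (f p)" using f G unfolding cyc_iso_def by blast
    thus ?thesis using w unfolding inner_edge_def by blast
  qed
qed

text \<open>For \<open>N\<close> above all labels in use, this makes \<open>e\<close> the smallest one.\<close>

definition rot :: "nat \<Rightarrow> nat \<Rightarrow> nat \<Rightarrow> nat" where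
  "rot e N x = (if x < e then x + N else x)"

lemma cyc_iso_rot:
  assumes "\<And>g. g \<in> G \<Longrightarrow> g < N" "e \<in> G"
  shows "cyc_iso G (rot e N)"
  unfolding cyc_iso_def
proof (intro conjI ballI)
  show "inj_on (rot e N) G" using assms unfolding inj_on_def rot_def by (auto split: if_splits)
  fix a b c assume "a \<in> G" "b \<in> G" "c \<in> G"
  hence "a < N" "b < N" "c < N" "e < N" using assms by auto
  thus "cyc (rot e N a) (rot e N b) (rot e N c) = cyc a b c"
    unfolding cyc_def rot_def by auto
qed

lemma Min_rot:
  assumes "finite G" "\<And>g. g \<in> G \<Longrightarrow> g < N" "e \<in> G"
  shows "Min (rot e N ` G) = rot e N e"
proof (rule Min_eqI)
  fix y assume "y \<in> rot e N ` G"
  thus "rot e N e \<le> y" using assms(2)[OF assms(3)] unfolding rot_def by auto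
qed (use assms in auto)

lemma cyc_Min:
  assumes "finite G" "e = Min G" "a \<in> G" "b \<in> G"
  shows "cyc e a b \<longleftrightarrow> e < a \<and> a < b" "cyc a b e \<longleftrightarrow> e < a \<and> a < b" "cyc b e a \<longleftrightarrow> e < a \<and> a < b"
proof -
  have "e \<le> a" "e \<le> b" using assms by auto
  thus "cyc e a b \<longleftrightarrow> e < a \<and> a < b" "cyc a b e \<longleftrightarrow> e < a \<and> a < b" "cyc b e a \<longleftrightarrow> e < a \<and> a < b"
    unfolding cyc_def by auto
qed

lemma crosses_complement:
  assumes "A \<subseteq> G" "B \<subseteq> G"
  shows "crosses (G - A) (G - B) \<longleftrightarrow> crosses A B"
proof -
  have "(G - A) - (G - B) = B - A" "(G - B) - (G - A) = A - B" using assms by auto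
  thus ?thesis unfolding crosses_def[of "G - A"] crosses_sym[of A B] crosses_def[of B A] by simp
qed

lemma full_complement:
  assumes C: "full G m C"
  shows "full G (card G - m) ((\<lambda>S. G - S) ` C)"
proof -
  note F = fullD[OF C]
  have inj: "inj_on (\<lambda>S. G - S) C" using F(7) by (intro inj_onI) blast
  have "noncrossing ((\<lambda>S. G - S) ` C)"
    unfolding noncrossing_def using crosses_complement F(7,10) by simp
  moreover have "(\<lambda>S. G - S) ` C \<subseteq> {S. S \<subseteq> G \<and> card S = card G - m}"
    using F(7-9) by (auto simp: card_Diff_subset)
  ultimately show ?thesis
    unfolding full_def using F(1,2,4) card_image[OF inj] by (simp add: mult.commute)
qed

text \<open>The complement of \<open>insert p W\<close> contains \<open>q\<close> and not
  \<open>p\<close>: complementation reverses the edge. Hence white and black vertices are exchanged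
  in \<open>third_complement\<close>.\<close>

lemma edge_complement:
  assumes ed: "edge G m C W p q"
  shows "edge G (card G - m) ((\<lambda>S. G - S) ` C) (G - insert p (insert q W)) q p"
proof -
  note E = edgeD[OF ed]
  have "insert q (G - insert p (insert q W)) = G - insert p W"
    "insert p (G - insert p (insert q W)) = G - insert q W" using E by auto
  thus ?thesis unfolding edge_def using full_complement[OF E(1)] E by simp
qed

lemma third_complement:
  assumes ed: "edge G m C W p q"
    and th: "third ((\<lambda>S. G - S) ` C) (G - insert p (insert q W)) q p"
  shows "third C W p q"
proof -
  note E = edgeD[OF ed]
  note F = fullD[OF E(1)]
  have mem_C: "G - S \<in> C" if "S \<in> (\<lambda>S. G - S) ` C" for S
    using that F(7) by (metis (no_types, lifting) double_diff image_iff order_refl)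
  from th show ?thesis unfolding third_def[of "(\<lambda>S. G - S) ` C"]
  proof (elim disjE exE bexE conjE)
    fix v assume v: "v \<notin> G - insert p (insert q W)" "cyc q v p"
      "insert v (G - insert p (insert q W)) \<in> (\<lambda>S. G - S) ` C"
    have "v \<in> G" using v(3) by blast
    hence vW: "v \<in> W" using v unfolding cyc_def by auto
    have "G - insert v (G - insert p (insert q W)) = insert p (insert q W) - {v}" using E vW by auto
    thus ?thesis using mem_C[OF v(3)] v vW unfolding third_def by auto
  next
    fix w assume w: "w \<in> G - insert p (insert q W)" "cyc p w q"
      "insert q (insert p (G - insert p (insert q W))) - {w} \<in> (\<lambda>S. G - S) ` C"
    have "G - (insert q (insert p (G - insert p (insert q W))) - {w}) = insert w W" using E w by auto
    thus ?thesis using mem_C[OF w(3)] w unfolding third_def by auto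
  qed
qed

section \<open>Induction on the number of labels\<close>

definition third_below :: "nat \<Rightarrow> bool" where
  "third_below k \<longleftrightarrow> (\<forall>G m C W p q. card G < k \<longrightarrow> edge G m C W p q \<longrightarrow> inner_edge G W p q \<longrightarrow> third C W p q)"

lemma rotate_to_front:
  assumes ed: "edge G m C W p q" and e: "e \<in> G"
  obtains f where "cyc_iso G f" "f e = Min (f ` G)"
    "edge (f ` G) m ((`) f ` C) (f ` W) (f p) (f q)"
    "third ((`) f ` C) (f ` W) (f p) (f q) \<Longrightarrow> third C W p q"
proof -
  note E = edgeD[OF ed]
  note F = fullD[OF E(1)]
  define N where "N = Suc (Max G)"
  have N: "g < N" if "g \<in> G" for g using that F(1) unfolding N_def by (simp add: less_Suc_eq_le)
  have f: "cyc_iso G (rot e N)" using cyc_iso_rot N e by blast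
  show ?thesis
    using that[OF f] Min_rot[OF F(1) N e] edge_cyc_iso[OF f ed] third_cyc_iso[OF f ed] by simp
qed

text \<open>The push map fixes sets that avoid the least label, so both ends of the edge survive the
  removal of \<open>e\<close>.\<close>

lemma third_pushed:
  assumes IH: "third_below (card G)" and ed: "edge G m C W p q" and e: "e = Min G" "e \<notin> W" "e \<noteq> p" "e \<noteq> q"
    and i: "inner_edge (G - {e}) W p q"
  shows "third (push G ` C) W p q"
proof -
  note E = edgeD[OF ed]
  note F = fullD[OF E(1)]
  have eG: "e \<in> G" using e(1) F(1) E(7) by (metis Min_in empty_iff)
  have fix_: "push G S = S" if "S \<in> C" "e \<notin> S" for S
  proof -
    have s: "finite G" "S \<subseteq> G" "card S < card G" using F(1,7,8) E(12) that by auto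
    have "gap G S = e" using gap_props[OF s] eG that(2) e(1) by (metis le_neq_implies_less)
    thus ?thesis unfolding push_def using that e(1) by auto
  qed
  have "insert x W \<in> push G ` C" if "insert x W \<in> C" "e \<noteq> x" for x
    using fix_[OF that(1)] that e(2) by (metis image_eqI insertE)
  hence "edge (G - {e}) m (push G ` C) W p q"
    unfolding edge_def using full_push(1)[OF E(1,12)] E e by blast
  moreover have "card (G - {e}) < card G" using card_Diff1_less[OF F(1) eG] .
  ultimately show ?thesis using IH i unfolding third_below_def by blast
qed

text \<open>The gap \<open>e\<close> of \<open>W\<close> on the black side is rotated to the front
  and pushed away; \<open>u\<close> then bounds the gaps in \<open>third_step\<close>.\<close>

lemma third_case_gap:
  assumes IH: "third_below (card G)" and ed: "edge G m C W p q"
    and e: "e \<in> G" "e \<notin> W" "cyc q e p" and u: "u \<in> G" "u \<notin> W" "u \<noteq> p" "cyc e u q"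
    and i: "inner_edge (G - {e}) W p q"
  shows "third C W p q"
proof -
  note E = edgeD[OF ed]
  note F = fullD[OF E(1)]
  obtain f where f: "cyc_iso G f" "f e = Min (f ` G)"
    "edge (f ` G) m ((`) f ` C) (f ` W) (f p) (f q)"
    "third ((`) f ` C) (f ` W) (f p) (f q) \<Longrightarrow> third C W p q"
    using rotate_to_front[OF ed e(1)] by blast
  have inj: "inj_on f G" using f unfolding cyc_iso_def by blast
  have n: "f x \<notin> f ` W" if "x \<in> G" "x \<notin> W" for x
    using that inj E(9) by (meson inj_on_image_mem_iff)
  have fin: "finite (f ` G)" using F(1) by simp
  have "cyc (f q) (f e) (f p)" "cyc (f e) (f u) (f q)" using f(1) e u E unfolding cyc_iso_def by blast+
  hence o: "f e < f p" "f p < f q" "f e < f u" "f u < f q"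
    using cyc_Min[OF fin f(2)] E u by auto
  have ne: "f u \<noteq> f p" using inj u E by (metis inj_onD)
  have "inner_edge (f ` (G - {e})) (f ` W) (f p) (f q)"
    using inner_edge_cyc_iso[OF f(1) _ _ E(7,8) i] E(9) e by blast
  moreover have "f ` (G - {e}) = f ` G - {f e}" using inj e by (auto simp: inj_on_def)
  ultimately have "third (push (f ` G) ` (`) f ` C) (f ` W) (f p) (f q)"
    using third_pushed[OF _ f(3) f(2) n[OF e(1,2)]] o IH card_image[OF inj] by simp
  hence "third ((`) f ` C) (f ` W) (f p) (f q)"
    using third_step[OF f(3) f(2) n[OF e(1,2)] o(1,2) _ n[OF u(1,2)] ne o(3,4)] u by blast
  thus ?thesis by (rule f(4))
qed

text \<open>Starting the circle at \<open>p\<close> orders the arc linearly, and its maximum is the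
  label sought.\<close>

lemma ex_last_in_arc:
  assumes "finite S" "S \<noteq> {}" "\<And>s. s \<in> S \<Longrightarrow> cyc p s q"
  shows "\<exists>l\<in>S. \<forall>g\<in>S. \<not> cyc l g q"
proof -
  define N where "N = Suc (Max (insert p (insert q S)))"
  have N: "g < N" if "g \<in> insert p (insert q S)" for g
    using that assms(1) Max_ge[of "insert p (insert q S)" g] unfolding N_def by (simp add: less_Suc_eq_le)
  have "Max (rot p N ` S) \<in> rot p N ` S" using assms(1,2) by (intro Max_in) auto
  then obtain l where l: "l \<in> S" "Max (rot p N ` S) = rot p N l" by blast
  have le: "rot p N g \<le> rot p N l" if "g \<in> S" for g
    using Max_ge[of "rot p N ` S" "rot p N g"] assms(1) that l(2) by simp
  have "\<not> cyc l g q" if g: "g \<in> S" for g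
  proof
    assume "cyc l g q"
    moreover have "g < N" "l < N" "p < N" "q < N" using N g l by auto
    ultimately show False using le[OF g] assms(3)[OF g] assms(3)[OF l(1)]
      unfolding rot_def cyc_def by (auto split: if_splits)
  qed
  thus ?thesis using l by blast
qed

text \<open>Here \<open>W\<close> fills the black arc, so no gap is available there. Instead the
  last two labels \<open>e\<close> and \<open>e'\<close> of the white arc are used: after rotation
  they and \<open>q\<close> come first, as \<open>third_step_adjacent\<close> requires.\<close>

lemma third_case_arcs:
  assumes IH: "third_below (card G)" and ed: "edge G m C W p q"
    and W: "\<And>g. g \<in> G \<Longrightarrow> cyc q g p \<Longrightarrow> g \<in> W" "\<And>g. g \<in> W \<Longrightarrow> \<not> cyc p g q"
    and xy: "x \<in> G" "y \<in> G" "x \<noteq> y" "cyc p x q" "cyc p y q"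
  shows "third C W p q"
proof -
  note E = edgeD[OF ed]
  note F = fullD[OF E(1)]
  define I where "I = {g \<in> G. cyc p g q}"
  have I: "finite I" "x \<in> I" "y \<in> I" "\<And>s. s \<in> I \<Longrightarrow> cyc p s q" using F(1) xy unfolding I_def by auto
  obtain e' where e': "e' \<in> I" "\<And>g. g \<in> I \<Longrightarrow> \<not> cyc e' g q"
    using ex_last_in_arc[OF I(1) _ I(4)] I(2) by blast
  have "I - {e'} \<noteq> {}" using I(2,3) xy(3) by blast
  then obtain e where e: "e \<in> I" "e \<noteq> e'" "\<And>g. g \<in> I - {e'} \<Longrightarrow> \<not> cyc e g q"
    using ex_last_in_arc[of "I - {e'}" p q] I by blast
  have eG: "e \<in> G" "e' \<in> G" "cyc p e q" "cyc p e' q" using e e' unfolding I_def by auto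
  have eW: "e \<notin> W" "e' \<notin> W" using W(2) eG by auto
  have ee: "cyc e e' q" using e'(2)[OF e(1)] e(2) eG(3,4) unfolding cyc_def by auto
  obtain f where f: "cyc_iso G f" "f e = Min (f ` G)"
    "edge (f ` G) m ((`) f ` C) (f ` W) (f p) (f q)"
    "third ((`) f ` C) (f ` W) (f p) (f q) \<Longrightarrow> third C W p q"
    using rotate_to_front[OF ed eG(1)] by blast
  have inj: "inj_on f G" using f unfolding cyc_iso_def by blast
  have n: "f x \<notin> f ` W" if "x \<in> G" "x \<notin> W" for x
    using that inj E(9) by (meson inj_on_image_mem_iff)
  have fin: "finite (f ` G)" using F(1) by simp
  have "cyc (f p) (f e) (f q)" "cyc (f e) (f e') (f q)"
    using f(1) eG ee E unfolding cyc_iso_def by blast+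
  hence o: "f e < f q" "f q < f p" "f e < f e'" "f e' < f q"
    using cyc_Min[OF fin f(2)] E eG by auto
  have cons: "g = f e \<or> g = f e' \<or> g = f q" if g: "g \<in> f ` G" "g \<le> f q" for g
  proof (rule ccontr)
    assume ne: "\<not> ?thesis"
    obtain h where h: "h \<in> G" "g = f h" using g by blast
    have "f e \<le> f h" using h f(2) fin by simp
    hence lt: "f e < f h" "f h < f q" using ne h g(2) by auto
    have "cyc (f p) (f h) (f q)" "cyc (f e) (f h) (f q)" using lt o unfolding cyc_def by auto
    hence "cyc p h q" "cyc e h q" using f(1) h eG E(7,8) unfolding cyc_iso_def by blast+
    hence "h \<in> I" "h = e'" using e(3)[of h] h unfolding I_def by blast+
    thus False using ne h by blast
  qed
  have "inner_edge (G - {e}) W p q" using eG eW e(2) unfolding inner_edge_def by blast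
  hence "inner_edge (f ` (G - {e})) (f ` W) (f p) (f q)"
    using inner_edge_cyc_iso[OF f(1) _ _ E(7,8), of W "G - {e}"] E(9) eW(1) by blast
  moreover have "f ` (G - {e}) = f ` G - {f e}" using inj eG by (auto simp: inj_on_def)
  ultimately have "third (push (f ` G) ` (`) f ` C) (f ` W) (f p) (f q)"
    using third_pushed[OF _ f(3) f(2) n[OF eG(1) eW(1)]] o IH card_image[OF inj] by simp
  hence "third ((`) f ` C) (f ` W) (f p) (f q)"
    using third_step_adjacent[OF f(3) f(2) n[OF eG(1) eW(1)] n[OF eG(2) eW(2)] _ o(3,4,2) cons] eG by blast
  thus ?thesis by (rule f(4))
qed

lemma cyc_total: "a \<noteq> b \<Longrightarrow> b \<noteq> c \<Longrightarrow> a \<noteq> c \<Longrightarrow> cyc a b c \<or> cyc c b a"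
  unfolding cyc_def by auto

text \<open>The argument depends on the labels outside \<open>W\<close>, \<open>p\<close> and
  \<open>q\<close>. If there are none, each member misses one label and cannot be crossed; one is
  the case of \<open>third_single_gap\<close>; of two, the first one after \<open>q\<close> is
  pushed away and the other bounds the gaps.\<close>

lemma third_case_empty_arc:
  assumes IH: "third_below (card G)" and ed: "edge G m C W p q"
    and I: "\<And>g. g \<in> G \<Longrightarrow> \<not> cyc p g q" and w: "w \<in> W" "cyc q w p"
  shows "third C W p q"
proof -
  note E = edgeD[OF ed]
  note F = fullD[OF E(1)]
  define M where "M = G - insert p (insert q W)"
  have arc: "cyc q g p" if "g \<in> G" "g \<noteq> p" "g \<noteq> q" for g
    using cyc_total[of p g q] I[of g] that E(2) by auto
  have inner: "inner_edge G' W p q" for G' using w unfolding inner_edge_def by blast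
  consider (none) "M = {}" | (one) e where "M = {e}" | (two) e u where "e \<in> M" "u \<in> M" "e \<noteq> u" by blast
  thus ?thesis
  proof cases
    case none
    hence G: "G = insert p (insert q W)" using E unfolding M_def by auto
    have cG: "card G = Suc m" using G E by simp
    have "G - {w} \<in> C"
    proof (rule full_maximal[OF E(1)])
      show "card (G - {w}) = m" using cG F(1) w E(9) by auto
      fix R assume R: "R \<in> C"
      have "card (G - R) = 1" using card_Diff_subset[OF F(9,7)[OF R]] F(8)[OF R] cG by simp
      then obtain x where "G - R = {x}" by (rule card_1_singletonE)
      hence "R = G - {x}" using F(7)[OF R] by blast
      hence diff: "R - (G - {w}) \<subseteq> {w}" by blast
      show "\<not> crosses R (G - {w})"
      proof
        assume "crosses R (G - {w})"
        then obtain a b c where abc: "a \<in> R - (G - {w})" "c \<in> R - (G - {w})" "a < b" "b < c"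
          unfolding crosses_def by blast
        hence "a = w" "c = w" using diff by blast+
        thus False using abc(3,4) by simp
      qed
    qed auto
    thus ?thesis using w G unfolding third_def by auto
  next
    case one
    hence e: "e \<in> G" "e \<notin> W" "e \<noteq> p" "e \<noteq> q" "G = insert e (insert p (insert q W))"
      using E unfolding M_def by auto
    obtain f where f: "cyc_iso G f" "f e = Min (f ` G)"
      "edge (f ` G) m ((`) f ` C) (f ` W) (f p) (f q)"
      "third ((`) f ` C) (f ` W) (f p) (f q) \<Longrightarrow> third C W p q"
      using rotate_to_front[OF ed e(1)] by blast
    have inj: "inj_on f G" using f unfolding cyc_iso_def by blast
    have n: "f e \<notin> f ` W" using e inj E(9) by (meson inj_on_image_mem_iff)
    have fin: "finite (f ` G)" using F(1) by simp
    have wG: "w \<in> G" using w E(9) by blast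
    have c: "cyc (f q) (f e) (f p)" "cyc (f q) (f w) (f p)"
      using f(1) e arc[of e] w wG E(7,8) unfolding cyc_iso_def by blast+
    hence o: "f e < f p" "f p < f q" using cyc_Min[OF fin f(2)] E by auto
    have "f w < f p \<or> f q < f w" using c(2) o unfolding cyc_def by auto
    moreover have "f ` G = insert (f e) (insert (f p) (insert (f q) (f ` W)))"
      by (subst e(5)) simp
    ultimately have "third ((`) f ` C) (f ` W) (f p) (f q)"
      using third_single_gap[OF f(3) f(2) n o] w by blast
    thus ?thesis by (rule f(4))
  next
    case two
    have step: ?thesis if eu: "e \<in> M" "u \<in> M" "cyc q e u" for e u
    proof -
      have G: "e \<in> G" "e \<notin> W" "e \<noteq> p" "e \<noteq> q" "u \<in> G" "u \<notin> W" "u \<noteq> p" using eu unfolding M_def by auto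
      moreover have "cyc e u q" using eu(3) unfolding cyc_def by auto
      ultimately show ?thesis using third_case_gap[OF IH ed _ _ arc _ _ _ _ inner] by blast
    qed
    have "cyc q e u \<or> cyc q u e" using cyc_total[of q e u] two unfolding M_def cyc_def by auto
    thus ?thesis using step two by blast
  qed
qed

theorem third_vertex:
  assumes "edge G m C W p q" "inner_edge G W p q"
  shows "third C W p q"
proof -
  have "\<forall>G m C W p q. card G = k \<longrightarrow> edge G m C W p q \<longrightarrow> inner_edge G W p q \<longrightarrow> third C W p q" for k
  proof (induction k rule: less_induct)
    case (less k)
    hence IH: "third_below k" unfolding third_below_def by blast
    have gaps: "third C W p q"
      if ed: "edge G m C W p q" and k: "card G = k"
        and e: "e \<in> G" "e \<notin> W" "cyc q e p" and v: "v \<in> G" "v \<notin> W" "cyc p v q" for G m C W p q e v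
    proof -
      have "cyc e v q" "v \<noteq> p" "v \<noteq> e" using e v unfolding cyc_def by auto
      moreover from this have "inner_edge (G - {e}) W p q" using v unfolding inner_edge_def by blast
      ultimately show ?thesis using third_case_gap[OF _ ed e v(1,2)] IH k by blast
    qed
    show ?case
    proof (intro allI impI)
      fix G m C W p q assume k: "card G = k" and ed: "edge G m C W p q" and inn: "inner_edge G W p q"
      note E = edgeD[OF ed]
      note F = fullD[OF E(1)]
      define D W' where "D = (\<lambda>S. G - S) ` C" and "W' = G - insert p (insert q W)"
      have ed': "edge G (card G - m) D W' q p" using edge_complement[OF ed] unfolding D_def W'_def .
      have dual: "third C W p q" if "third D W' q p"
        using third_complement[OF ed] that unfolding D_def W'_def by blast
      have pq: "\<not> cyc p p q" "\<not> cyc p q q" "\<not> cyc q p p" "\<not> cyc q q p" unfolding cyc_def by auto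
      have W'1: "g \<in> W' \<longleftrightarrow> g \<notin> W" if "g \<in> G" "cyc p g q \<or> cyc q g p" for g
        using that pq unfolding W'_def by auto
      \<comment> \<open>Gaps on the black and white arcs, then elements of \<open>W\<close> on the
        white and black arcs. Complementation exchanges \<open>a\<close> with \<open>c\<close> and
        \<open>b\<close> with \<open>d\<close>.\<close>
      define a b c d where "a = (\<exists>e\<in>G - W. cyc q e p)" and "b = (\<exists>v\<in>G - W. cyc p v q)"
        and "c = (\<exists>w\<in>W. cyc p w q)" and "d = (\<exists>w\<in>W. cyc q w p)"
      note abcd = a_def b_def c_def d_def
      have bd: "b \<or> d" using inn unfolding inner_edge_def abcd by blast
      consider "a \<and> b" | "c \<and> d" | (diag) "\<not> a" "b" "d" "\<not> c" | (O) "\<not> a" "b" "\<not> d" | (I) "\<not> b" "d" "\<not> c"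
        using bd by blast
      thus "third C W p q"
      proof cases
        case 1
        thus ?thesis using gaps[OF ed k] unfolding abcd by blast
      next
        case 2
        then obtain w w' where w: "w \<in> W" "cyc p w q" "w' \<in> W" "cyc q w' p" unfolding abcd by blast
        hence "w \<in> G" "w' \<in> G" "w \<notin> W'" "w' \<notin> W'" using E(9) unfolding W'_def by auto
        thus ?thesis using gaps[OF ed' k _ _ w(2) _ _ w(4)] dual by blast
      next
        case diag
        obtain v w where v: "v \<in> G" "v \<notin> W" "cyc p v q" and w: "w \<in> W" "cyc q w p"
          using diag unfolding abcd by blast
        have 1: "g \<in> W" if "g \<in> G" "cyc q g p" for g using that diag(1) unfolding abcd by blast
        have 2: "\<not> cyc p g q" if "g \<in> W" for g using that diag(4) unfolding abcd by blast
        show ?thesis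
        proof (cases "\<exists>y\<in>G. y \<noteq> v \<and> cyc p y q")
          case True
          thus ?thesis using third_case_arcs[OF _ ed 1 2] IH k v by metis
        next
          case v1: False
          show ?thesis
          proof (cases "\<exists>y\<in>G. y \<noteq> w \<and> cyc q y p")
            case True
            then obtain y where y: "y \<in> G" "y \<noteq> w" "cyc q y p" by blast
            have 3: "g \<in> W'" if "g \<in> G" "cyc p g q" for g using that 2 W'1 by blast
            have 4: "\<not> cyc q g p" if "g \<in> W'" for g using that 1 unfolding W'_def by blast
            have "third D W' q p"
              using third_case_arcs[OF _ ed' 3 4, of y w] IH k y w E(9) by blast
            thus ?thesis by (rule dual)
          next
            case w1: False
            \<comment> \<open>A circle of four labels with \<open>m = 2\<close> is left. The
              candidates \<open>{v, w}\<close> and \<open>{p, q}\<close> are its two diagonals, and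
              a member crossing the first must be the second.\<close>
            have G: "g = p \<or> g = q \<or> g = v \<or> g = w" if "g \<in> G" for g
              using cyc_total[of p g q] that v1 w1 E(2) by metis
            have W: "W = {w}"
            proof -
              have "g = w" if "g \<in> W" for g
                using G[of g] 2[OF that] that E(3,4,9) v by blast
              thus ?thesis using w by blast
            qed
            have m: "m = 2" using E(11) W by simp
            have vw: "v \<noteq> w" "p \<noteq> v" "q \<noteq> v" using v w unfolding cyc_def by auto
            show ?thesis
            proof (cases "{v, w} \<in> C")
              case True
              thus ?thesis using v W unfolding third_def by auto
            next
              case False
              then obtain R where R: "R \<in> C" "crosses R {v, w}"
                using full_maximal[OF E(1), of "{v, w}"] v w E(9) m vw by auto
              then obtain s t where st: "s \<in> R" "t \<in> R" "s < t" "s \<notin> {v, w}" "t \<notin> {v, w}"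
                unfolding crosses_def using less_trans by blast
              hence "{s, t} = {p, q}" using G F(7)[OF R(1)] by blast
              hence "{p, q} \<subseteq> R" using st(1,2) by (metis empty_subsetI insert_subset)
              hence "R = {p, q}" using F(8,9)[OF R(1)] m E(2) card_subset_eq[of R "{p, q}"] by auto
              moreover have "insert p (insert q W) - {w} = {p, q}" using W E(3,4) by auto
              ultimately show ?thesis using R(1) w unfolding third_def by auto
            qed
          qed
        qed
      next
        case O
        have 1: "\<not> cyc q g p" if "g \<in> G" for g using that O unfolding abcd by blast
        obtain v where v: "v \<in> G" "v \<notin> W" "cyc p v q" using O unfolding abcd by blast
        hence "v \<in> W'" using W'1 by blast
        hence "third D W' q p" using third_case_empty_arc[OF _ ed' 1] IH k v by blast
        thus ?thesis by (rule dual)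
      next
        case I
        have 1: "\<not> cyc p g q" if "g \<in> G" for g using that I unfolding abcd by blast
        thus ?thesis using third_case_empty_arc[OF _ ed 1] IH k I unfolding abcd by blast
      qed
    qed
  qed
  thus ?thesis using assms by blast
qed

section \<open>Lowering flips that remove the largest element\<close>

text \<open>For \<open>T\<close> inside \<open>{1..n - 1}\<close> this is crossing of
  \<open>T\<close> and \<open>insert n R\<close>, with \<open>n\<close> as the fourth point.\<close>

definition blocks :: "nat set \<Rightarrow> nat set \<Rightarrow> bool" where
  "blocks R T \<longleftrightarrow> (\<exists>x d y. x < d \<and> d < y \<and> d \<in> R - T \<and> x \<in> T - R \<and> y \<in> T - R)"

lemma blocksI: "x < d \<Longrightarrow> d < y \<Longrightarrow> d \<in> R \<Longrightarrow> d \<notin> T \<Longrightarrow> x \<in> T \<Longrightarrow> x \<notin> R \<Longrightarrow> y \<in> T \<Longrightarrow> y \<notin> R \<Longrightarrow> blocks R T"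
  unfolding blocks_def by blast

text \<open>Equal sizes give a second point of \<open>R - A\<close>; outside the interval from
  \<open>x\<close> to \<open>y\<close> it would complete a crossing with \<open>d\<close>.\<close>

lemma ex_between:
  assumes fin: "finite A" "finite R" "card A = card R" and nc: "\<not> crosses A R"
    and x: "x \<in> A - R" "y \<in> A - R" "d \<in> R - A" "x < d" "d < y"
  shows "\<exists>z\<in>R - A. z \<noteq> d \<and> x < z \<and> z < y"
proof -
  obtain z where z: "z \<in> R - A" "z \<noteq> d"
    using ex_other_in_diff[OF fin x(1,2)] x(4,5) by auto
  have "\<not> (y < z \<or> z < x)" using nc crossesI[of x A R y d z] x z by blast
  moreover have "z \<noteq> x" "z \<noteq> y" using z x by auto
  ultimately have "x < z" "z < y" by auto
  thus ?thesis using z by blast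
qed

text \<open>If \<open>v\<close> is a witness, exchange it on the right for \<open>b\<close> and on
  the left for \<open>a\<close>. This fails only when the new label lies in \<open>R\<close>; then
  it completes a crossing, or \<open>R\<close> becomes too large. If \<open>d = b\<close>,
  \<open>ex_between\<close> supplies another middle point.\<close>

lemma blocks_mono_left:
  fixes X R :: "nat set"
  assumes fin: "finite X" "finite R" "card R = Suc (card X)"
    and o: "a < v" "v < b" and X: "a \<notin> X" "v \<notin> X" "b \<notin> X"
    and nc: "\<not> crosses (insert a X) R" "\<not> crosses (insert v X) R"
    and bl: "blocks R (insert a (insert v X))"
  shows "blocks R (insert a (insert b X))"
proof -
  obtain x d y where q: "x < d" "d < y" "d \<in> R" "d \<noteq> a" "d \<noteq> v" "d \<notin> X"
    "x = a \<or> x = v \<or> x \<in> X" "x \<notin> R" "y = a \<or> y = v \<or> y \<in> X" "y \<notin> R"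
    using bl unfolding blocks_def by blast
  have nca: False if "s = a \<or> s \<in> X" "s \<notin> R" "t = a \<or> t \<in> X" "t \<notin> R" "r \<in> R" "r \<noteq> a" "r \<notin> X"
    "z \<in> R" "z \<noteq> a" "z \<notin> X" "s < r" "r < t" "t < z \<or> z < s" for s t r z
    using nc(1) crossesI[of s "insert a X" R t r z] that by blast
  have ncv: False if "s = v \<or> s \<in> X" "s \<notin> R" "t = v \<or> t \<in> X" "t \<notin> R" "r \<in> R" "r \<noteq> v" "r \<notin> X"
    "z \<in> R" "z \<noteq> v" "z \<notin> X" "s < r" "r < t" "t < z \<or> z < s" for s t r z
    using nc(2) crossesI[of s "insert v X" R t r z] that by blast
  have cards: "card (insert a X) = card R" "card (insert v X) = card R" using fin X by auto
  have bl': ?thesis if "s < r" "r < t" "r \<in> R" "r \<noteq> a" "r \<noteq> b" "r \<notin> X"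
    "s = a \<or> s = b \<or> s \<in> X" "s \<notin> R" "t = a \<or> t = b \<or> t \<in> X" "t \<notin> R" for s r t
    using blocksI[of s r t R "insert a (insert b X)"] that by blast
  show ?thesis
  proof (cases "d = b")
    case False
    consider "x \<noteq> v" "y \<noteq> v" | "y = v" | "x = v" "y \<in> X" using q o by fastforce
    thus ?thesis
    proof cases
      case 1 thus ?thesis using bl'[of x d y] q False by blast
    next
      case 2
      show ?thesis
      proof (cases "b \<in> R")
        case False
        have "x \<noteq> v" "d < b" using q 2 o by auto
        thus ?thesis using bl'[of x d b] q \<open>d \<noteq> b\<close> False by blast
      next
        case True
        have "x = a"
        proof (rule ccontr)
          assume "x \<noteq> a"
          hence "x \<in> X" using q 2 by auto
          thus False using ncv[of x v d b] q 2 True o X by auto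
        qed
        have "X \<subseteq> R"
        proof
          fix z assume z: "z \<in> X"
          show "z \<in> R"
          proof (rule ccontr)
            assume zR: "z \<notin> R"
            have zdb: "z \<noteq> d" "z \<noteq> b" using zR q True by auto
            consider "z < d" | "d < z" "z < b" | "b < z" using zdb by linarith
            thus False
            proof cases
              case 1 thus False using ncv[of z v d b] z zR q 2 True o X by auto
            next
              case b: 2
              thus False using nca[of a z d b] z zR q True o X \<open>x = a\<close> by auto
            next
              case 3 thus False using ncv[of v z b d] z zR q 2 True o X by auto
            qed
          qed
        qed
        \<comment> \<open>\<open>R\<close> would contain \<open>X\<close> and the two further labels
          \<open>b\<close> and \<open>d\<close>, one element too many.\<close>
        hence "card (insert d (insert b X)) \<le> card R" using q True fin by (intro card_mono) auto
        thus ?thesis using fin q X \<open>d \<noteq> b\<close> by simp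
      qed
    next
      case 3
      show ?thesis
      proof (cases "a \<in> R")
        case False
        have "a < d" using q 3 o by auto
        thus ?thesis using bl'[of a d y] q 3 False \<open>d \<noteq> b\<close> by blast
      next
        case True
        thus ?thesis using ncv[of v y d a] q 3 o X by auto
      qed
    qed
  next
    case True
    have yX: "y \<in> X" using q True o by auto
    consider "x \<noteq> v" | "x = v" by blast
    thus ?thesis
    proof cases
      case 1
      obtain z where z: "z \<in> R - insert a X" "z \<noteq> d" "x < z" "z < y"
        using ex_between[of "insert a X" R x y d] fin cards nc(1) q yX 1 by blast
      thus ?thesis using bl'[of x z y] q yX 1 True by blast
    next
      case 2
      obtain z where z: "z \<in> R - insert v X" "z \<noteq> d" "x < z" "z < y"
        using ex_between[of "insert v X" R x y d] fin cards nc(2) q yX 2 by blast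
      show ?thesis
      proof (cases "a \<in> R")
        case False
        have "a < z" "z \<noteq> a" using z 2 o by auto
        thus ?thesis using bl'[of a z y] q yX True False z by blast
      next
        case aR: True
        thus ?thesis using ncv[of v y d a] q yX 2 o X by auto
      qed
    qed
  qed
qed

text \<open>Mirror image of \<open>blocks_mono_left\<close> under reversal of the order.\<close>

lemma blocks_mono_right:
  fixes X R :: "nat set"
  assumes fin: "finite X" "finite R" "card R = Suc (card X)"
    and o: "a < v" "v < b" and X: "a \<notin> X" "v \<notin> X" "b \<notin> X"
    and nc: "\<not> crosses (insert b X) R" "\<not> crosses (insert v X) R"
    and bl: "blocks R (insert v (insert b X))"
  shows "blocks R (insert a (insert b X))"
proof -
  obtain x d y where q: "x < d" "d < y" "d \<in> R" "d \<noteq> b" "d \<noteq> v" "d \<notin> X"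
    "x = b \<or> x = v \<or> x \<in> X" "x \<notin> R" "y = b \<or> y = v \<or> y \<in> X" "y \<notin> R"
    using bl unfolding blocks_def by blast
  have ncb: False if "s = b \<or> s \<in> X" "s \<notin> R" "t = b \<or> t \<in> X" "t \<notin> R" "r \<in> R" "r \<noteq> b" "r \<notin> X"
    "z \<in> R" "z \<noteq> b" "z \<notin> X" "s < r" "r < t" "t < z \<or> z < s" for s t r z
    using nc(1) crossesI[of s "insert b X" R t r z] that by blast
  have ncv: False if "s = v \<or> s \<in> X" "s \<notin> R" "t = v \<or> t \<in> X" "t \<notin> R" "r \<in> R" "r \<noteq> v" "r \<notin> X"
    "z \<in> R" "z \<noteq> v" "z \<notin> X" "s < r" "r < t" "t < z \<or> z < s" for s t r z
    using nc(2) crossesI[of s "insert v X" R t r z] that by blast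
  have cards: "card (insert b X) = card R" "card (insert v X) = card R" using fin X by auto
  have bl': ?thesis if "s < r" "r < t" "r \<in> R" "r \<noteq> a" "r \<noteq> b" "r \<notin> X"
    "s = a \<or> s = b \<or> s \<in> X" "s \<notin> R" "t = a \<or> t = b \<or> t \<in> X" "t \<notin> R" for s r t
    using blocksI[of s r t R "insert a (insert b X)"] that by blast
  show ?thesis
  proof (cases "d = a")
    case False
    consider "x \<noteq> v" "y \<noteq> v" | "x = v" | "y = v" "x \<in> X" using q o by fastforce
    thus ?thesis
    proof cases
      case 1 thus ?thesis using bl'[of x d y] q False by blast
    next
      case 2
      show ?thesis
      proof (cases "a \<in> R")
        case False
        have "y \<noteq> v" "a < d" using q 2 o by auto
        thus ?thesis using bl'[of a d y] q \<open>d \<noteq> a\<close> False by blast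
      next
        case True
        have "y = b"
        proof (rule ccontr)
          assume "y \<noteq> b"
          hence "y \<in> X" using q 2 by auto
          thus False using ncv[of v y d a] q 2 True o X by auto
        qed
        have "X \<subseteq> R"
        proof
          fix z assume z: "z \<in> X"
          show "z \<in> R"
          proof (rule ccontr)
            assume zR: "z \<notin> R"
            have zda: "z \<noteq> d" "z \<noteq> a" using zR q True by auto
            consider "z < a" | "a < z" "z < d" | "d < z" using zda by linarith
            thus False
            proof cases
              case 1 thus False using ncv[of z v a d] z zR q 2 True o X by auto
            next
              case b: 2
              thus False using ncb[of z b d a] z zR q True o X \<open>y = b\<close> by auto
            next
              case 3 thus False using ncv[of v z d a] z zR q 2 True o X by auto
            qed
          qed
        qed
        hence "card (insert d (insert a X)) \<le> card R" using q True fin by (intro card_mono) auto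
        thus ?thesis using fin q X \<open>d \<noteq> a\<close> by simp
      qed
    next
      case 3
      show ?thesis
      proof (cases "b \<in> R")
        case False
        have "d < b" using q 3 o by auto
        thus ?thesis using bl'[of x d b] q 3 False \<open>d \<noteq> a\<close> by blast
      next
        case True
        thus ?thesis using ncv[of x v d b] q 3 o X by auto
      qed
    qed
  next
    case True
    have xX: "x \<in> X" using q True o by auto
    consider "y \<noteq> v" | "y = v" by blast
    thus ?thesis
    proof cases
      case 1
      obtain z where z: "z \<in> R - insert b X" "z \<noteq> d" "x < z" "z < y"
        using ex_between[of "insert b X" R x y d] fin cards nc(1) q xX 1 by blast
      thus ?thesis using bl'[of x z y] q xX 1 True by blast
    next
      case 2
      obtain z where z: "z \<in> R - insert v X" "z \<noteq> d" "x < z" "z < y"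
        using ex_between[of "insert v X" R x y d] fin cards nc(2) q xX 2 by blast
      show ?thesis
      proof (cases "b \<in> R")
        case False
        have "z < b" "z \<noteq> b" using z 2 o by auto
        thus ?thesis using bl'[of x z b] q xX True False z by blast
      next
        case bR: True
        thus ?thesis using ncv[of x v d b] q xX 2 o X by auto
      qed
    qed
  qed
qed

definition link :: "nat \<Rightarrow> nat set set \<Rightarrow> nat set set" where
  "link n C = {Y. n \<notin> Y \<and> insert n Y \<in> C}"

text \<open>A chord set with the fewest blocking members of the link lies directly under the strand \<open>n\<close>; there
  the third vertex lemma yields the square of a flip.\<close>

definition chord_sets :: "nat \<Rightarrow> nat set set \<Rightarrow> nat set set" where
  "chord_sets n C = {T. n \<notin> T \<and> T \<notin> C \<and> (\<exists>a\<in>T. \<exists>b\<in>T. a \<noteq> b \<and> T - {a} \<in> link n C \<and> T - {b} \<in> link n C)}"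

lemma insert_max_not_crosses:
  assumes "\<not> crosses (insert n A) (insert n B)" "n \<notin> A" "n \<notin> B"
  shows "\<not> crosses A B"
proof -
  have "insert n A - insert n B = A - B" "insert n B - insert n A = B - A" using assms by auto
  thus ?thesis using assms unfolding crosses_def by simp
qed

lemma lowering_flip_of_chord:
  assumes C: "full {1..n} m C" and ne: "chord_sets n C \<noteq> {}"
  shows "\<exists>C'. lowering_flip n m C C'"
proof -
  note F = fullD[OF C]
  define bl where "bl T = {R \<in> link n C. blocks R T}" for T
  have linkD: "Y \<subseteq> {1..n} - {n}" "finite Y" "Suc (card Y) = m" if "Y \<in> link n C" for Y
    using that F(7)[of "insert n Y"] F(8)[of "insert n Y"] F(9)[of "insert n Y"]
    unfolding link_def by auto
  have linknc: "\<not> crosses Y Z" if "Y \<in> link n C" "Z \<in> link n C" for Y Z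
    using insert_max_not_crosses[of n Y Z] F(10) that unfolding link_def by blast
  have "finite (Pow {1..n})" by simp
  hence finl: "finite (link n C)" by (rule finite_subset[rotated]) (use linkD(1) in blast)
  obtain T where T: "T \<in> chord_sets n C" and Tmin: "\<And>T'. T' \<in> chord_sets n C \<Longrightarrow> card (bl T) \<le> card (bl T')"
    using ex_has_least_nat[of "\<lambda>T. T \<in> chord_sets n C" _ "\<lambda>T. card (bl T)"] ne by blast
  define B where "B = {w \<in> T. T - {w} \<in> link n C}"
  obtain a0 b0 where ab0: "a0 \<in> B" "b0 \<in> B" "a0 \<noteq> b0" and Tn: "n \<notin> T" "T \<notin> C"
    using T unfolding chord_sets_def B_def by blast
  have finT: "finite T" using linkD(2)[of "T - {a0}"] ab0 unfolding B_def by simp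
  hence finB: "finite B" unfolding B_def by simp
  \<comment> \<open>The extreme labels whose removal from \<open>T\<close> lands in the link; this
    choice rules out a black vertex with \<open>w\<close> in \<open>X\<close>.\<close>
  define a b where "a = Min B" and "b = Max B"
  have aB: "a \<in> B" "b \<in> B" using ab0 finB unfolding a_def b_def by (metis Min_in Max_in empty_iff)+
  have ext: "a \<le> w" "w \<le> b" if "w \<in> B" for w using that finB unfolding a_def b_def by auto
  have ab: "a < b" using ext[OF ab0(1)] ext[OF ab0(2)] ab0(3) by linarith
  define X where "X = T - {a, b}"
  have TX: "T = insert a (insert b X)" "a \<notin> X" "b \<notin> X" "n \<notin> X" "a \<noteq> n" "b \<noteq> n"
    using aB Tn ab unfolding X_def B_def by auto
  have lab: "insert a X \<in> link n C" "insert b X \<in> link n C"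
  proof -
    have "T - {b} = insert a X" "T - {a} = insert b X" using TX ab by auto
    thus "insert a X \<in> link n C" "insert b X \<in> link n C" using aB unfolding B_def by auto
  qed
  have bn: "b < n" "1 \<le> a" using linkD(1)[OF lab(2)] linkD(1)[OF lab(1)] by auto
  have finX: "finite X" using finT X_def by simp
  have ed: "edge {1..n} m C (insert n X) a b"
    unfolding edge_def using C ab TX lab unfolding link_def by (auto simp: insert_commute)
  \<comment> \<open>The label \<open>n\<close> belongs to \<open>insert n X\<close> and lies on the
    arc from \<open>b\<close> to \<open>a\<close>, so the edge is inner.\<close>
  have "cyc b n a" using bn ab unfolding cyc_def by simp
  hence "third C (insert n X) a b" using third_vertex[OF ed] unfolding inner_edge_def by blast
  then obtain v where v: "a < v" "v < b" "v \<notin> X" "insert v X \<in> link n C"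
    unfolding third_def
  proof (elim disjE exE bexE conjE)
    fix v assume v: "v \<notin> insert n X" "cyc a v b" "insert v (insert n X) \<in> C"
    thus thesis using that[of v] ab TX unfolding cyc_def link_def by (auto simp: insert_commute)
  next
    fix w assume w: "w \<in> insert n X" "cyc b w a" "insert a (insert b (insert n X)) - {w} \<in> C"
    \<comment> \<open>A black vertex with \<open>w = n\<close> would be \<open>T\<close> itself,
      which is not in \<open>C\<close>.\<close>
    have "insert a (insert b (insert n X)) - {n} = T" using TX by auto
    hence wn: "w \<noteq> n" using w Tn by auto
    hence wX: "w \<in> X" using w by simp
    have "insert a (insert b (insert n X)) - {w} = insert n (T - {w})" using TX wX wn by auto
    hence "w \<in> B" using w wX TX Tn unfolding B_def link_def by auto
    thus thesis using ext[of w] w(2) ab unfolding cyc_def by auto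
  qed
  have vn: "v \<noteq> n" using v bn by auto
  have vbl: "insert v X \<in> bl T" using v TX blocksI[of a v b "insert v X" T] ab unfolding bl_def by auto
  \<comment> \<open>If \<open>T'\<close> were missing from \<open>C\<close>, it would be a chord
    set. Its blocking members would be among those of \<open>T\<close> but would not include
    \<open>insert v X\<close>, against the minimal choice of \<open>T\<close>.\<close>
  have inC: "T' \<in> C" if T': "T' = insert s (insert t X)" "s \<noteq> t" "s \<notin> X" "t \<notin> X" "s \<noteq> n" "t \<noteq> n"
    "insert s X \<in> link n C" "insert t X \<in> link n C" and vT: "v \<in> T'"
    and mono: "\<And>R. R \<in> link n C \<Longrightarrow> blocks R T' \<Longrightarrow> blocks R T" for T' s t
  proof (rule ccontr)
    assume "T' \<notin> C"
    have "T' - {t} = insert s X" "T' - {s} = insert t X" using T' by auto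
    hence "T' \<in> chord_sets n C" using \<open>T' \<notin> C\<close> T' TX unfolding chord_sets_def by auto
    hence "card (bl T) \<le> card (bl T')" by (rule Tmin)
    moreover have "bl T' \<subset> bl T"
    proof -
      have "insert v X \<subseteq> T'" using vT T'(1) by auto
      hence "insert v X \<notin> bl T'" unfolding bl_def blocks_def by blast
      thus ?thesis using vbl mono unfolding bl_def by blast
    qed
    hence "card (bl T') < card (bl T)" using finl psubset_card_mono[of "bl T" "bl T'"] unfolding bl_def by simp
    ultimately show False by simp
  qed
  have R: "finite R" "card R = Suc (card X)" "\<not> crosses (insert a X) R" "\<not> crosses (insert b X) R"
    "\<not> crosses (insert v X) R" if "R \<in> link n C" for R
    using linkD(2,3)[OF that] linkD(3)[OF lab(1)] finX TX linknc[OF lab(1) that] linknc[OF lab(2) that]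
      linknc[OF v(4) that] by auto
  have T1: "insert a (insert v X) \<in> C"
  proof (rule inC[OF refl])
    fix R assume Rl: "R \<in> link n C" and "blocks R (insert a (insert v X))"
    thus "blocks R T" unfolding TX(1)
      using blocks_mono_left[OF finX R(1,2)[OF Rl] v(1,2) TX(2) v(3) TX(3) R(3,5)[OF Rl]] by blast
  qed (use v TX lab vn in auto)
  have T2: "insert v (insert b X) \<in> C"
  proof (rule inC[OF refl])
    fix R assume Rl: "R \<in> link n C" and "blocks R (insert v (insert b X))"
    thus "blocks R T" unfolding TX(1)
      using blocks_mono_right[OF finX R(1,2)[OF Rl] v(1,2) TX(2) v(3) TX(3) R(4,5)[OF Rl]] by blast
  qed (use v TX lab vn in auto)
  have lk: "X \<union> {s, n} \<in> C" if "insert s X \<in> link n C" for s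
  proof -
    have "X \<union> {s, n} = insert n (insert s X)" by auto
    thus ?thesis using that unfolding link_def by simp
  qed
  \<comment> \<open>The flip uses \<open>a\<close>, \<open>v\<close>, \<open>b\<close>,
    \<open>n\<close> as \<open>i\<close>, \<open>j\<close>, \<open>k\<close>, \<open>l\<close>: it
    replaces \<open>X \<union> {v, n}\<close> by \<open>T\<close>.\<close>
  have "X \<union> {a, v} = insert a (insert v X)" "X \<union> {v, b} = insert v (insert b X)" "X \<union> {a, b} = T"
    using TX(1) by auto
  moreover have "X \<subseteq> {1..n} - {a, v, b, n}" using linkD(1)[OF lab(1)] TX v by auto
  moreover have "card X + 2 = m" using linkD(3)[OF lab(1)] TX finX by simp
  ultimately have "flip_frame n m C X a v b n" "X \<union> {v, n} \<in> C" "X \<union> {a, b} \<notin> C"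
    using T1 T2 lk lab v bn Tn unfolding flip_frame_def by auto
  thus ?thesis unfolding lowering_flip_def by blast
qed

section \<open>Cyclic intervals through the largest label\<close>

definition wrap_ints :: "nat \<Rightarrow> nat \<Rightarrow> nat set set" where
  "wrap_ints n m = (\<lambda>p. {1..p} \<union> {n - m + p + 1..n}) ` {..<m}"

lemma wrap_intsI: "p < m \<Longrightarrow> K = {1..p} \<union> {n - m + p + 1..n} \<Longrightarrow> K \<in> wrap_ints n m"
  unfolding wrap_ints_def by blast

text \<open>The complement of \<open>K\<close> is an interval, so no element of \<open>K\<close>
  separates two labels outside \<open>K\<close>, and nothing crosses \<open>K\<close>.\<close>

lemma wrap_ints_props:
  assumes "m \<le> n" "K \<in> wrap_ints n m"
  shows "K \<subseteq> {1..n}" "card K = m" "n \<in> K" "S \<subseteq> {1..n} \<Longrightarrow> \<not> crosses S K"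
proof -
  obtain p where p: "p < m" "K = {1..p} \<union> {n - m + p + 1..n}" using assms unfolding wrap_ints_def by blast
  show "K \<subseteq> {1..n}" "n \<in> K" using p assms by auto
  have "card K = card {1..p} + card {n - m + p + 1..n}" unfolding p(2) by (rule card_Un_disjoint) auto
  thus "card K = m" using p assms by simp
  assume S: "S \<subseteq> {1..n}"
  show "\<not> crosses S K"
  proof
    assume "crosses S K"
    hence "crosses K S" using crosses_sym by blast
    then obtain a b c d where q: "a \<in> K" "c \<in> K" "b \<in> S - K" "d \<in> S - K" "a < b" "b < c" "c < d \<or> d < a"
      unfolding crosses_def by blast
    have "p < b" "b < n - m + p + 1" "p < d" "d < n - m + p + 1" using q(3,4) S p(2) by auto
    thus False using q(1,2,5-7) p(2) by auto
  qed
qed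

lemma wrap_ints_subset_full: "full {1..n} m C \<Longrightarrow> wrap_ints n m \<subseteq> C"
proof
  fix K assume C: "full {1..n} m C" and K: "K \<in> wrap_ints n m"
  have "m \<le> n" using fullD(2)[OF C] by simp
  thus "K \<in> C" using full_maximal[OF C] wrap_ints_props[OF _ K] fullD(7)[OF C] by blast
qed

text \<open>The labels missing from \<open>R\<close> do not form an interval, so some
  \<open>d\<close> in \<open>R\<close> lies between the least missing label \<open>u\<close> and the
  greatest one \<open>v\<close>. Two consecutive cyclic intervals span a set \<open>T\<close> that
  contains \<open>u\<close> and \<open>v\<close> but neither \<open>d\<close> nor \<open>n\<close>,
  and hence crosses \<open>R\<close>.\<close>

lemma ex_chord_set:
  assumes C: "full {1..n} m C" and R: "R \<in> C" "n \<in> R" "R \<notin> wrap_ints n m"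
  shows "chord_sets n C \<noteq> {}"
proof -
  note F = fullD[OF C]
  have mn: "m \<le> n" using F(2) by simp
  have RG: "R \<subseteq> {1..n}" "card R = m" "finite R" using F(7-9) R by auto
  have m0: "0 < m" using RG R(2) card_gt_0_iff by blast
  define M where "M = {1..n} - R"
  have cM: "card M = n - m" using card_Diff_subset[OF RG(3,1)] RG unfolding M_def by simp
  have finM: "finite M" unfolding M_def by simp
  have M: "M \<noteq> {}"
  proof
    assume "M = {}"
    hence "R = {1..n}" "n = m" using RG cM mn unfolding M_def by auto
    thus False using R(3) m0 wrap_intsI[of 0 m R n] by simp
  qed
  define u v where "u = Min M" and "v = Max M"
  have uv: "u \<in> M" "v \<in> M" "\<And>x. x \<in> M \<Longrightarrow> u \<le> x \<and> x \<le> v"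
    using finM M unfolding u_def v_def by auto
  have uv': "1 \<le> u" "v < n" "u \<notin> R" "v \<notin> R" "u \<le> v"
    using uv R(2) unfolding M_def by (auto simp: order.strict_iff_order)
  have "\<exists>d\<in>R. u < d \<and> d < v"
  proof (rule ccontr)
    assume no: "\<not> ?thesis"
    have inM: "x \<in> M" if "u \<le> x" "x \<le> v" for x
      using that no uv uv' unfolding M_def by (cases "x = u"; cases "x = v") (auto simp: order.strict_iff_order)
    have Mi: "M = {u..v}"
    proof (intro set_eqI iffI)
      fix x assume "x \<in> M" thus "x \<in> {u..v}" using uv(3)[of x] by simp
    next
      fix x assume "x \<in> {u..v}" thus "x \<in> M" using inM[of x] by simp
    qed
    hence vu: "n - m = v + 1 - u" using cM by simp
    have "R = {1..u - 1} \<union> {v + 1..n}"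
    proof -
      have memR: "x \<in> R \<longleftrightarrow> x \<in> {1..n} \<and> \<not> (u \<le> x \<and> x \<le> v)" for x
        using RG Mi unfolding M_def by (metis DiffD2 DiffI atLeastAtMost_iff subsetD)
      show ?thesis unfolding set_eq_iff memR using uv'(1,2,5) by auto
    qed
    moreover have "v + 1 = n - m + (u - 1) + 1" "u - 1 < m" using vu uv' mn by auto
    ultimately show False using R(3) wrap_intsI[of "u - 1" m R n] by metis
  qed
  then obtain d where d: "d \<in> R" "u < d" "d < v" by blast
  have "x \<in> {u..v} - {d}" if "x \<in> M" for x using uv(3)[OF that] d(1) that unfolding M_def by auto
  hence "M \<subseteq> {u..v} - {d}" by blast
  hence "n - m \<le> card ({u..v} - {d})" using cM card_mono[of "{u..v} - {d}" M] by simp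
  hence k1: "n - m + u \<le> v" using d by simp
  have "{u, v} \<subseteq> M" "u \<noteq> v" using uv d by auto
  hence k2: "2 \<le> n - m" using cM card_mono[OF finM, of "{u, v}"] by simp
  \<comment> \<open>The smallest \<open>s\<close> with \<open>u \<le> s\<close> and
    \<open>d < n - m + s\<close>. By \<open>k1\<close> and \<open>d < v\<close> the label
    \<open>n - m + s\<close> stays at most \<open>v\<close>, and \<open>k2\<close> keeps
    \<open>s\<close> below \<open>d\<close>.\<close>
  define s where "s = max u (d + 1 - (n - m))"
  have s: "u \<le> s" "s < d" "d < n - m + s" "n - m + s \<le> v" "1 \<le> s" "s < m"
    using d k1 k2 uv' mn unfolding s_def by auto
  define T where "T = {1..s} \<union> {n - m + s..n - 1}"
  have "insert n (T - {s}) = {1..s - 1} \<union> {n - m + (s - 1) + 1..n}"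
    using s uv' k2 mn unfolding T_def by auto
  hence l1: "insert n (T - {s}) \<in> wrap_ints n m" using s(6) by (intro wrap_intsI[of "s - 1"]) auto
  have "insert n (T - {n - m + s}) = {1..s} \<union> {n - m + s + 1..n}"
    using s uv' k2 mn unfolding T_def by auto
  hence l2: "insert n (T - {n - m + s}) \<in> wrap_ints n m" using s(6) by (intro wrap_intsI[of s])
  have nT: "n \<notin> T" using s mn uv' unfolding T_def by auto
  have "crosses T R"
    by (rule crossesI[of u T R v d n]) (use s d uv' R(2) nT in \<open>auto simp: T_def\<close>)
  hence "T \<notin> C" using F(10) R(1) by blast
  moreover have "s \<in> T" "n - m + s \<in> T" "s \<noteq> n - m + s" using s uv' k2 unfolding T_def by auto
  moreover have "T - {s} \<in> link n C" "T - {n - m + s} \<in> link n C"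
    using l1 l2 wrap_ints_subset_full[OF C] nT unfolding link_def by auto
  ultimately show ?thesis using nT unfolding chord_sets_def by blast
qed

section \<open>Weak separation and the collection IS\<close>

text \<open>For equal sizes the size conditions hold automatically. Without a crossing, one
  difference lies entirely before the other or splits into a part before and a part after
  it.\<close>

lemma weakly_separated_iff:
  assumes fin: "finite X" "finite Y" "card X = card Y"
  shows "weakly_separated X Y \<longleftrightarrow> X \<noteq> Y \<and> \<not> crosses X Y"
proof
  have surr: "\<not> crosses A B \<and> A \<noteq> B" if sAB: "set_surr A B" for A B
  proof -
    obtain B1 B2 where B: "B1 \<union> B2 = B - A" "A - B \<noteq> {}" "set_prec B1 (A - B)" "set_prec (A - B) B2"
      using sAB unfolding set_surr_def by blast
    have lt: "i < j" if "i \<in> B1" "j \<in> A - B" for i j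
    proof -
      have "i \<in> B1 - (A - B)" "j \<in> (A - B) - B1" using B(1) that by blast+
      thus ?thesis using B(3) unfolding set_prec_def by blast
    qed
    have gt: "j < i" if "i \<in> B2" "j \<in> A - B" for i j
    proof -
      have "i \<in> B2 - (A - B)" "j \<in> (A - B) - B2" using B(1) that by blast+
      thus ?thesis using B(4) unfolding set_prec_def by blast
    qed
    have "\<not> crosses A B"
    proof
      assume "crosses A B"
      then obtain a b c where q: "a \<in> A - B" "c \<in> A - B" "b \<in> B - A" "a < b" "b < c"
        unfolding crosses_def by blast
      hence "b \<in> B1 \<or> b \<in> B2" using B(1) by blast
      thus False using lt[of b a] gt[of b c] q by auto
    qed
    thus ?thesis using B(2) by blast
  qed
  have prec: "\<not> crosses A B \<and> A \<noteq> B" if "set_prec A B" for A B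
  proof -
    have "\<not> crosses A B"
    proof
      assume "crosses A B"
      then obtain b c where "c \<in> A - B" "b \<in> B - A" "b < c" unfolding crosses_def by blast
      thus False using that unfolding set_prec_def by (meson less_asym)
    qed
    thus ?thesis using that unfolding set_prec_def by blast
  qed
  show "X \<noteq> Y \<and> \<not> crosses X Y" if "weakly_separated X Y"
    using that prec surr crosses_sym unfolding weakly_separated_def by blast
next
  assume nc: "X \<noteq> Y \<and> \<not> crosses X Y"
  \<comment> \<open>The difference that starts first either precedes the other or surrounds
    it.\<close>
  have main: "set_prec A B \<or> set_surr B A"
    if A: "finite A" "finite B" "card A = card B" "A \<noteq> B" "\<not> crosses A B"
      and least: "a \<in> A - B" "\<And>b. b \<in> B - A \<Longrightarrow> a < b" for A B a
  proof -
    define y where "y = Min (B - A)"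
    have neB: "B - A \<noteq> {}" using ex_in_diff[of B A] A(1-4) by auto
    have y: "y \<in> B - A" "\<And>b. b \<in> B - A \<Longrightarrow> y \<le> b" 
      using Min_in[OF finite_Diff[OF A(2)] neB] Min_le[OF finite_Diff[OF A(2)]] unfolding y_def by blast+
    \<comment> \<open>Otherwise \<open>a < y < x < b\<close> would be a crossing.\<close>
    have far: "b < x" if x: "x \<in> A - B" "y < x" and b: "b \<in> B - A" for x b
    proof (rule ccontr)
      assume "\<not> b < x"
      hence "x < b" using x b by (metis DiffD1 DiffD2 antisym_conv3)
      thus False using A(5) crossesI[of a A B x y b] least y x b by blast
    qed
    show ?thesis
    proof (cases "\<exists>x\<in>A - B. y < x")
      case False
      have "i < j" if "i \<in> A - B" "j \<in> B - A" for i j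
      proof -
        have "i \<noteq> y" using that y(1) by blast
        hence "i < y" using False that by (meson antisym_conv3)
        thus ?thesis using y(2)[OF that(2)] by simp
      qed
      thus ?thesis using neB unfolding set_prec_def by blast
    next
      case True
      define A1 A2 where "A1 = {x \<in> A - B. x < y}" and "A2 = {x \<in> A - B. y < x}"
      have "set_surr B A" unfolding set_surr_def
      proof (intro exI conjI)
        have "x < y \<or> y < x" if "x \<in> A - B" for x
          using that y(1) by (metis DiffD1 DiffD2 antisym_conv3)
        thus "A1 \<union> A2 = A - B" unfolding A1_def A2_def by blast
        show "A1 \<inter> A2 = {}" unfolding A1_def A2_def by auto
        show "A1 \<noteq> {}" using least(1) least(2)[OF y(1)] unfolding A1_def by blast
        show "A2 \<noteq> {}" using True unfolding A2_def by blast
        show "B - A \<noteq> {}" by (rule neB)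
        show "set_prec A1 (B - A)"
          using neB y(2) unfolding set_prec_def A1_def by fastforce
        show "set_prec (B - A) A2"
          using True far unfolding set_prec_def A2_def by blast
      qed
      thus ?thesis by blast
    qed
  qed
  define x y where "x = Min (X - Y)" and "y = Min (Y - X)"
  have ne: "X - Y \<noteq> {}" "Y - X \<noteq> {}" using ex_in_diff[of X Y] ex_in_diff[of Y X] fin nc by auto
  have x: "x \<in> X - Y" "\<And>z. z \<in> X - Y \<Longrightarrow> x \<le> z"
    using Min_in[OF finite_Diff[OF fin(1)] ne(1)] Min_le[OF finite_Diff[OF fin(1)]] unfolding x_def by blast+
  have y: "y \<in> Y - X" "\<And>z. z \<in> Y - X \<Longrightarrow> y \<le> z"
    using Min_in[OF finite_Diff[OF fin(2)] ne(2)] Min_le[OF finite_Diff[OF fin(2)]] unfolding y_def by blast+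
  have "x \<noteq> y" using x y by blast
  hence "x < y \<or> y < x" by linarith
  thus "weakly_separated X Y"
  proof
    assume "x < y"
    hence "x < b" if "b \<in> Y - X" for b using y(2)[OF that] by simp
    thus ?thesis using main[of X Y x] fin nc x unfolding weakly_separated_def by fastforce
  next
    assume "y < x"
    hence "y < b" if "b \<in> X - Y" for b using x(2)[OF that] by simp
    thus ?thesis using main[of Y X y] fin nc y crosses_sym[of X Y] unfolding weakly_separated_def by fastforce
  qed
qed

lemma ws_collection_iff:
  assumes "C \<subseteq> Delta n m"
  shows "ws_collection C \<longleftrightarrow> noncrossing C"
proof -
  have fc: "finite X \<and> card X = m" if "X \<in> C" for X
    using that assms finite_subset[of X "{1..n}"] unfolding Delta_def by auto
  have iff: "weakly_separated X Y \<longleftrightarrow> X \<noteq> Y \<and> \<not> crosses X Y" if "X \<in> C" "Y \<in> C" for X Y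
    using weakly_separated_iff[of X Y] fc[OF that(1)] fc[OF that(2)] by simp
  show ?thesis unfolding ws_collection_def noncrossing_def
  proof (intro iffI ballI impI)
    fix X Y assume "\<forall>X\<in>C. \<forall>Y\<in>C. X \<noteq> Y \<longrightarrow> weakly_separated X Y" "X \<in> C" "Y \<in> C"
    thus "\<not> crosses X Y" using iff[of X Y] by (cases "X = Y") auto
  next
    fix X Y assume "\<forall>X\<in>C. \<forall>Y\<in>C. \<not> crosses X Y" "X \<in> C" "Y \<in> C" "X \<noteq> Y"
    thus "weakly_separated X Y" using iff[of X Y] by simp
  qed
qed

text \<open>A common form for both families in \<open>IS\<close>: \<open>s = 0\<close> gives the
  intervals, \<open>s = t\<close> or \<open>s = m\<close> the initial one, and
  \<open>0 < s < m\<close> with \<open>s < t\<close> two separate blocks.\<close>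

definition seg :: "nat \<Rightarrow> nat \<Rightarrow> nat \<Rightarrow> nat set" where
  "seg m s t = {1..s} \<union> {t + 1..t + (m - s)}"

lemma IS_eq:
  assumes "m \<le> n"
  shows "S \<in> IS n m \<longleftrightarrow> (\<exists>s t. S = seg m s t \<and> s \<le> m \<and> s \<le> t \<and> t + (m - s) \<le> n)" (is "_ \<longleftrightarrow> ?J")
proof
  assume "S \<in> IS n m"
  then consider p q where "card S = m" "1 \<le> p" "q \<le> n" "S = {p..q}"
    | p q r where "card S = m" "1 \<le> p" "p + 1 < q" "q \<le> r" "r \<le> n" "S = {1..p} \<union> {q..r}"
    unfolding IS_def by blast
  thus ?J
  proof cases
    case 1
    \<comment> \<open>For \<open>m = 0\<close> the interval is empty and its ends are arbitrary, so
      they cannot supply the parameters.\<close>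
    show ?thesis
    proof (cases "m = 0")
      case True
      hence "S = seg m 0 0" using 1 by (simp add: seg_def)
      moreover have "0 + (m - 0) \<le> n" using True by simp
      ultimately show ?thesis by blast
    next
      case False
      have "Suc q - p = m" using 1(1,4) by simp
      hence q: "q = (p - 1) + m" using 1(2) False by linarith
      hence "S = seg m 0 (p - 1)" "(p - 1) + (m - 0) \<le> n" using 1 by (auto simp: seg_def)
      thus ?thesis by blast
    qed
  next
    case 2
    have "card S = card {1..p} + card {q..r}" unfolding 2(6) by (rule card_Un_disjoint) (use 2 in auto)
    hence m: "m = p + (r + 1 - q)" using 2 by simp
    hence r: "(q - 1) + (m - p) = r" "(q - 1) + 1 = q" using 2 by auto
    have "S = seg m p (q - 1)" unfolding seg_def r using 2(6) .
    moreover have "p \<le> m" "p \<le> q - 1" "(q - 1) + (m - p) \<le> n" using m r 2 by auto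
    ultimately show ?thesis by blast
  qed
next
  assume ?J
  then obtain s t where st: "S = seg m s t" "s \<le> m" "s \<le> t" "t + (m - s) \<le> n" by blast
  have S: "S = {1..s} \<union> {t + 1..t + (m - s)}" using st(1) unfolding seg_def .
  have "card S = card {1..s} + card {t + 1..t + (m - s)}"
    unfolding S by (rule card_Un_disjoint) (use st in auto)
  hence c: "card S = m" using st(2) by simp
  consider "s = m \<or> s = t" | "s = 0" | "0 < s" "s < m" "s < t" using st by linarith
  thus "S \<in> IS n m"
  proof cases
    case 1
    hence "S = {1..m}" using S st(2) by auto
    thus ?thesis using c assms unfolding IS_def by blast
  next
    case 2
    hence "S = {t + 1..t + m}" "1 \<le> t + 1" "t + m \<le> n" using S st by auto
    thus ?thesis using c unfolding IS_def by blast
  next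
    case 3
    hence "1 \<le> s" "s + 1 < t + 1" "t + 1 \<le> t + (m - s)" by auto
    thus ?thesis using c S st(4) unfolding IS_def by blast
  qed
qed

lemma IS_self: "IS m m = {{1..m}}"
proof (intro set_eqI iffI)
  fix S assume "S \<in> IS m m"
  then obtain s t where "S = seg m s t" "s \<le> m" "s \<le> t" "t + (m - s) \<le> m"
    using IS_eq[of m m S] by auto
  thus "S \<in> {{1..m}}" by (auto simp: seg_def)
next
  fix S assume "S \<in> {{1..m}}"
  hence "S = seg m m m" by (simp add: seg_def)
  moreover have "m + (m - m) \<le> m" by simp
  ultimately show "S \<in> IS m m" using IS_eq[of m m S] by blast
qed

text \<open>A member reaching the bound \<open>Suc n\<close> is a cyclic interval through that
  label, unless its second block is empty; then it is the initial interval, already in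
  \<open>IS n m\<close>.\<close>

lemma IS_Suc:
  assumes m: "m \<le> n"
  shows "IS (Suc n) m = IS n m \<union> wrap_ints (Suc n) m"
proof (intro equalityI subsetI)
  have mS: "m \<le> Suc n" using m by simp
  note iff = IS_eq[OF m] and iffS = IS_eq[OF mS]
  {
    fix S assume "S \<in> IS (Suc n) m"
    then obtain s t where st: "S = seg m s t" "s \<le> m" "s \<le> t" "t + (m - s) \<le> Suc n"
      using iffS by blast
    consider "t + (m - s) \<le> n" | "t + (m - s) = Suc n" "s = m" | "t + (m - s) = Suc n" "s < m" using st by linarith
    thus "S \<in> IS n m \<union> wrap_ints (Suc n) m"
    proof cases
      case 1 thus ?thesis using st iff by blast
    next
      case 2
      hence "S = seg m m m" using st(1) by (simp add: seg_def)
      moreover have "m + (m - m) \<le> n" using m by simp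
      ultimately show ?thesis using iff by blast
    next
      case 3
      hence t: "t = Suc n - m + s" using m by linarith
      have "S = {1..s} \<union> {Suc n - m + s + 1..Suc n}" using st(1) 3(1) t unfolding seg_def by metis
      thus ?thesis using 3(2) wrap_intsI[of s m S "Suc n"] by blast
    qed
  next
    fix S assume "S \<in> IS n m \<union> wrap_ints (Suc n) m"
    thus "S \<in> IS (Suc n) m"
    proof
      assume "S \<in> IS n m"
      then obtain s t where "S = seg m s t" "s \<le> m" "s \<le> t" "t + (m - s) \<le> n" using iff by blast
      moreover from this have "t + (m - s) \<le> Suc n" by simp
      ultimately show ?thesis using iffS by blast
    next
      assume "S \<in> wrap_ints (Suc n) m"
      then obtain p where p: "p < m" "S = {1..p} \<union> {Suc n - m + p + 1..Suc n}" unfolding wrap_ints_def by blast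
      have e: "(Suc n - m + p) + (m - p) = Suc n" using p(1) m by simp
      have "S = seg m p (Suc n - m + p)" unfolding seg_def e using p(2) .
      moreover have "p \<le> m" "p \<le> Suc n - m + p" "(Suc n - m + p) + (m - p) \<le> Suc n" using p(1) e by auto
      ultimately show ?thesis using iffS by blast
    qed
  }
qed

text \<open>Since \<open>m < n\<close> leaves a gap after \<open>p\<close>, the label
  \<open>p + 1\<close> separates the set with parameter \<open>p\<close> from those with larger
  ones.\<close>

lemma card_wrap_ints:
  assumes "m < n"
  shows "card (wrap_ints n m) = m"
proof -
  have ne: "{1..p} \<union> {n - m + p + 1..n} \<noteq> {1..p'} \<union> {n - m + p' + 1..n}" if "p < p'" "p' < m" for p p'
  proof -
    have "p + 1 \<notin> {1..p} \<union> {n - m + p + 1..n}" "p + 1 \<in> {1..p'} \<union> {n - m + p' + 1..n}" using that assms by auto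
    thus ?thesis by blast
  qed
  have "inj_on (\<lambda>p. {1..p} \<union> {n - m + p + 1..n}) {..<m}"
  proof (rule inj_onI)
    fix p p' assume "p \<in> {..<m}" "p' \<in> {..<m}"
      "{1..p} \<union> {n - m + p + 1..n} = {1..p'} \<union> {n - m + p' + 1..n}"
    thus "p = p'" using ne[of p p'] ne[of p' p] by (metis antisym_conv3 lessThan_iff)
  qed
  thus ?thesis unfolding wrap_ints_def by (simp add: card_image)
qed

text \<open>Nothing crosses the \<open>m\<close> new sets, and they account exactly for the growth
  of the size bound; \<open>full_restrict\<close> is the same count backwards.\<close>

lemma full_extend:
  assumes D: "full {1..n} m D"
  shows "full {1..Suc n} m (D \<union> wrap_ints (Suc n) m)"
proof -
  note F = fullD[OF D]
  have m: "m \<le> n" using F(2) by simp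
  have mS: "m \<le> Suc n" using m by simp
  note K = wrap_ints_props[OF mS]
  have sub: "D \<union> wrap_ints (Suc n) m \<subseteq> {S. S \<subseteq> {1..Suc n} \<and> card S = m}"
  proof
    fix S assume "S \<in> D \<union> wrap_ints (Suc n) m"
    thus "S \<in> {S. S \<subseteq> {1..Suc n} \<and> card S = m}" using F(7,8)[of S] K(1,2)[of S] by fastforce
  qed
  have "noncrossing (D \<union> wrap_ints (Suc n) m)" unfolding noncrossing_def
  proof (intro ballI)
    fix A B assume AB: "A \<in> D \<union> wrap_ints (Suc n) m" "B \<in> D \<union> wrap_ints (Suc n) m"
    hence s: "A \<subseteq> {1..Suc n}" "B \<subseteq> {1..Suc n}" using sub by blast+
    show "\<not> crosses A B"
      using AB F(10)[of A B] K(4)[of B A] K(4)[of A B] s crosses_sym[of A B] by blast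
  qed
  moreover have "card (D \<union> wrap_ints (Suc n) m) = card D + m"
  proof -
    have "Suc n \<notin> S" if "S \<in> D" for S using F(7)[OF that] by auto
    hence "D \<inter> wrap_ints (Suc n) m = {}" using K(3) by blast
    moreover have "finite (wrap_ints (Suc n) m)" unfolding wrap_ints_def by simp
    ultimately show ?thesis using card_Un_disjoint[OF F(5)] card_wrap_ints[of m "Suc n"] m by simp
  qed
  ultimately show ?thesis unfolding full_def using sub F(4) m by (simp add: Suc_diff_le)
qed

lemma full_IS: "m \<le> n \<Longrightarrow> full {1..n} m (IS n m)"
proof (induction n rule: dec_induct)
  case base
  show ?case unfolding full_def IS_self noncrossing_def by simp
next
  case (step n)
  thus ?case using full_extend IS_Suc by simp
qed

lemma full_restrict:
  assumes C: "full {1..Suc n} m C" and m: "m \<le> n"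
    and all: "\<And>R. R \<in> C \<Longrightarrow> Suc n \<in> R \<Longrightarrow> R \<in> wrap_ints (Suc n) m"
  shows "full {1..n} m {R \<in> C. Suc n \<notin> R}" "C = {R \<in> C. Suc n \<notin> R} \<union> wrap_ints (Suc n) m"
proof -
  note F = fullD[OF C]
  have mS: "m \<le> Suc n" using m by simp
  note K = wrap_ints_props[OF mS]
  let ?D = "{R \<in> C. Suc n \<notin> R}"
  show eq: "C = ?D \<union> wrap_ints (Suc n) m" using all wrap_ints_subset_full[OF C] by blast
  have "?D \<inter> wrap_ints (Suc n) m = {}" using K(3) by blast
  moreover have "finite (wrap_ints (Suc n) m)" unfolding wrap_ints_def by simp
  ultimately have "card (?D \<union> wrap_ints (Suc n) m) = card ?D + m"
    using card_Un_disjoint[of ?D "wrap_ints (Suc n) m"] F(5) card_wrap_ints[of m "Suc n"] m by simp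
  hence "card ?D + m = m * (Suc n - m) + 1" using F(4) eq by simp
  hence c: "card ?D = m * (n - m) + 1" using m by (simp add: Suc_diff_le)
  have "noncrossing ?D" using F(3) unfolding noncrossing_def by blast
  moreover have "?D \<subseteq> {S. S \<subseteq> {1..n} \<and> card S = m}"
  proof clarify
    fix S assume S: "S \<in> C" "Suc n \<notin> S"
    have "x \<le> n" if "x \<in> S" for x
      using F(7)[OF S(1)] that S(2) by (metis atLeastAtMost_iff le_Suc_eq subsetD)
    thus "S \<subseteq> {1..n} \<and> card S = m" using F(7,8)[OF S(1)] by auto
  qed
  ultimately show "full {1..n} m ?D" unfolding full_def using c m by simp
qed

text \<open>Either a member with the largest label is not a cyclic interval, and a chord set gives
  the flip, or a flip of the members without that label is also a flip of \<open>C\<close>.\<close>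

lemma ex_lowering_flip:
  assumes "full {1..n} m C" "C \<noteq> IS n m"
  shows "\<exists>C'. lowering_flip n m C C'"
  using assms
proof (induction n arbitrary: C)
  case 0
  note F = fullD[OF 0(1)]
  have m: "m = 0" using F(2) by simp
  hence "C \<subseteq> {{}}" using F(7) by auto
  moreover have "C \<noteq> {}" using F(4) by auto
  ultimately have "C = IS 0 m" using IS_self[of 0] m by auto
  thus ?case using 0(2) by simp
next
  case (Suc n)
  note F = fullD[OF Suc.prems(1)]
  show ?case
  proof (cases "\<exists>R\<in>C. Suc n \<in> R \<and> R \<notin> wrap_ints (Suc n) m")
    case True
    thus ?thesis using lowering_flip_of_chord[OF Suc.prems(1)] ex_chord_set[OF Suc.prems(1)] by blast
  next
    case no: False
    show ?thesis
    proof (cases "m = Suc n")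
      case True
      have "S = {1..Suc n}" if "S \<in> C" for S
        using F(7,8)[OF that] True by (intro card_subset_eq) auto
      moreover have "C \<noteq> {}" using F(4) by auto
      ultimately have "C = {{1..Suc n}}" by blast
      hence "C = IS (Suc n) m" using IS_self[of "Suc n"] True by simp
      thus ?thesis using Suc.prems(2) by simp
    next
      case False
      hence m: "m \<le> n" using F(2) by simp
      define D where "D = {R \<in> C. Suc n \<notin> R}"
      have D: "full {1..n} m D" "C = D \<union> wrap_ints (Suc n) m"
        using full_restrict[OF Suc.prems(1) m] no unfolding D_def by blast+
      have "D \<noteq> IS n m" using D(2) IS_Suc[OF m] Suc.prems(2) by blast
      then obtain C' where "lowering_flip n m D C'" using Suc.IH[OF D(1)] by blast
      then obtain X i j k l where fl: "flip_frame n m D X i j k l" "X \<union> {j, l} \<in> D" "X \<union> {i, k} \<notin> D"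
        unfolding lowering_flip_def by blast
      have fr: "flip_frame (Suc n) m C X i j k l" "X \<union> {j, l} \<in> C"
        using fl D(2) unfolding flip_frame_def by auto
      have "Suc n \<notin> X \<union> {i, k}" using fl(1) unfolding flip_frame_def by auto
      hence "X \<union> {i, k} \<notin> C" using fl(3) unfolding D_def by blast
      thus ?thesis using fr unfolding lowering_flip_def by blast
    qed
  qed
qed

section \<open>Flips preserve maximum size\<close>

text \<open>A crossing with \<open>X \<union> {i, k}\<close> passes to one of the four other sets
  unless \<open>j\<close> and \<open>l\<close> lie in \<open>R\<close> and separate two points
  outside \<open>R\<close>. These must be \<open>i\<close> and \<open>k\<close>; then
  \<open>X\<close> is contained in \<open>R\<close>, and counting makes \<open>R\<close> the set
  excluded by \<open>ne\<close>.\<close>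

lemma flip_not_crosses:
  fixes X R :: "nat set"
  assumes fin: "finite X" "finite R" "card R = card X + 2"
    and o: "i < j" "j < k" "k < l" and X: "i \<notin> X" "j \<notin> X" "k \<notin> X" "l \<notin> X"
    and nc: "\<not> crosses (X \<union> {i, j}) R" "\<not> crosses (X \<union> {k, l}) R" "\<not> crosses (X \<union> {i, l}) R"
      "\<not> crosses (X \<union> {j, k}) R"
    and ne: "R \<noteq> X \<union> {j, l}"
  shows "\<not> crosses (X \<union> {i, k}) R"
proof
  assume "crosses (X \<union> {i, k}) R"
  then obtain a c b d where q: "a \<in> X \<union> {i, k}" "a \<notin> R" "c \<in> X \<union> {i, k}" "c \<notin> R"
    "b \<in> R" "b \<notin> X \<union> {i, k}" "d \<in> R" "d \<notin> X \<union> {i, k}" "a < b" "b < c" "c < d \<or> d < a"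
    unfolding crosses_def by blast
  have o': "i < k" "i < l" "j < l" using o by auto
  have rule: "crosses (X \<union> {s, t}) R" if "a \<in> X \<union> {s, t}" "a \<notin> R" "c \<in> X \<union> {s, t}" "c \<notin> R"
    "b \<in> R" "b \<notin> X \<union> {s, t}" "d \<in> R" "d \<notin> X \<union> {s, t}" "a < b" "b < c" "c < d \<or> d < a" for a b c d s t
    using that by (intro crossesI[of a _ _ c b d])
  have jl: "j \<in> R \<and> l \<in> R \<and> (\<exists>x\<in>X \<union> {i, k}. \<exists>y\<in>X \<union> {i, k}. x \<notin> R \<and> y \<notin> R \<and> j < x \<and> x < l \<and> (y < j \<or> l < y))"
  proof -
    have inside: ?thesis if bj: "b = j \<or> d = j" and bl: "b = l \<or> d = l"
    proof -
      consider "b = j" "d = l" | "b = l" "d = j" using bj bl o' by auto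
      thus ?thesis
      proof cases
        case 1
        hence "j < c" "c < l" "a < j" using q(9-11) o' by auto
        thus ?thesis using q 1 by blast
      next
        case 2
        hence "j < a" "a < l" "l < c" using q(9-11) o' by auto
        thus ?thesis using q 2 by blast
      qed
    qed
    consider "a \<noteq> k" "c \<noteq> k" | "a \<noteq> i" "c \<noteq> i" | "a = i" "c = k" using q o' by fastforce
    thus ?thesis
    proof cases
      case 1
      have "b = j \<or> d = j" using rule[of a i j c b d] nc(1) q 1 by blast
      moreover have "b = l \<or> d = l" using rule[of a i l c b d] nc(3) q 1 by blast
      ultimately show ?thesis by (rule inside)
    next
      case 2
      have "b = j \<or> d = j" using rule[of a j k c b d] nc(4) q 2 by blast
      moreover have "b = l \<or> d = l" using rule[of a k l c b d] nc(2) q 2 by blast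
      ultimately show ?thesis by (rule inside)
    next
      case 3
      have "j \<in> R"
      proof (rule ccontr)
        assume j: "j \<notin> R"
        hence bd: "b \<noteq> j" "d \<noteq> j" using q by auto
        show False
        proof (cases "b < j")
          case True
          hence "j < d \<or> d < i" "i < b" using q(9,11) 3 o by auto
          thus False using rule[of i i j j b d] nc(1) q 3 j bd True by blast
        next
          case False
          hence "j < b" "b < k" "k < d \<or> d < j" using q(9-11) 3 o bd by auto
          thus False using rule[of j j k k b d] nc(4) q 3 j bd by blast
        qed
      qed
      moreover have "l \<in> R"
      proof (rule ccontr)
        assume l: "l \<notin> R"
        hence dl: "b \<noteq> l" "d \<noteq> l" "b < l" using q 3 o by auto
        consider "k < d" "d < l" | "l < d" | "d < i" using q(11) 3 dl(2) by linarith
        thus False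
        proof cases
          case 1 thus False using rule[of k k l l d b] nc(2) q 3 l dl by blast
        next
          case b: 2 thus False using rule[of i i l l b d] nc(3) q 3 l dl by blast
        next
          case b: 3 thus False using rule[of i i l l b d] nc(3) q 3 l dl by blast
        qed
      qed
      ultimately show ?thesis using q 3 o by blast
    qed
  qed
  \<comment> \<open>Counting gives a further point \<open>z\<close> of \<open>R\<close>. To avoid a
    crossing with \<open>X \<union> {u, l}\<close> it lies on the same side of \<open>x\<close> and
    \<open>y\<close> as \<open>j\<close>, hence opposite to \<open>l\<close>, and this is a crossing
    with \<open>X \<union> {u, j}\<close>.\<close>
  have step: False if xy: "x \<in> X \<union> {u}" "y \<in> X \<union> {u}" "x \<notin> R" "y \<notin> R" "j < x" "x < l" "y < j \<or> l < y"
    and u: "u \<noteq> j" "u \<noteq> l" "u \<notin> X" and n: "\<not> crosses (X \<union> {u, j}) R" "\<not> crosses (X \<union> {u, l}) R" for x y u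
  proof -
    have cl: "card (X \<union> {u, l}) = card R" "card (X \<union> {u, j}) = card R" "finite (X \<union> {u, l})" "finite (X \<union> {u, j})"
      using fin X u by auto
    have ne: "x \<noteq> y" using xy by auto
    obtain z where z: "z \<in> R" "z \<notin> X \<union> {u, l}" "z \<noteq> j"
      using ex_other_in_diff[of "X \<union> {u, l}" R x y j] cl fin xy ne by auto
    have zx: "z \<noteq> x" "z \<noteq> y" "z \<noteq> l" using z xy by auto
    have jl': "j \<in> R" "l \<in> R" "j \<notin> X \<union> {u, l}" "l \<notin> X \<union> {u, j}" "z \<notin> X \<union> {u, j}" using jl X u o' z by auto
    have i1: "y < j \<Longrightarrow> y < z \<and> z < x"
      using rule[of y u l x j z] n(2) xy z zx jl' by (metis UnCI UnE insertCI insertE antisym_conv3 singletonD)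
    have i2: "l < y \<Longrightarrow> z < x \<or> y < z"
      using rule[of x u l y z j] n(2) xy z zx jl' by (metis UnCI UnE insertCI insertE antisym_conv3 singletonD)
    have i3: "y < j \<Longrightarrow> \<not> (y < z \<and> z < x)"
      using rule[of y u j x z l] n(1) xy z zx jl' by blast
    have i4: "l < y \<Longrightarrow> \<not> (z < x \<or> y < z)"
      using rule[of x u j y l z] n(1) xy z zx jl' by blast
    show False using i1 i2 i3 i4 xy(7) by blast
  qed
  have comm: "X \<union> {j, i} = X \<union> {i, j}" "X \<union> {l, k} = X \<union> {k, l}" "X \<union> {l, i} = X \<union> {i, l}" "X \<union> {k, j} = X \<union> {j, k}"
    by auto
  have si: False if "x \<in> X \<union> {i}" "y \<in> X \<union> {i}" "x \<notin> R" "y \<notin> R" "j < x" "x < l" "y < j \<or> l < y" for x y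
    using step[of x i y] that o o' X nc by auto
  have sk: False if "x \<in> X \<union> {k}" "y \<in> X \<union> {k}" "x \<notin> R" "y \<notin> R" "j < x" "x < l" "y < j \<or> l < y" for x y
    using step[of x k y] that o o' X nc comm by auto
  obtain x y where xy: "x \<in> X \<union> {i, k}" "y \<in> X \<union> {i, k}" "x \<notin> R" "y \<notin> R" "j < x" "x < l" "y < j \<or> l < y"
    using jl by blast
  have yi: "y = i"
  proof (rule ccontr)
    assume "y \<noteq> i"
    hence "y \<in> X" "x \<in> X \<union> {k}" using xy o o' by auto
    thus False using sk[of x y] xy by blast
  qed
  have xk: "x = k"
  proof (rule ccontr)
    assume "x \<noteq> k"
    hence "x \<in> X \<union> {i}" using xy by auto
    thus False using si[of x y] xy yi by blast
  qed
  \<comment> \<open>A point of \<open>X\<close> outside \<open>R\<close> could replace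
    \<open>k\<close> or \<open>i\<close> as one of the separated points.\<close>
  have "z \<in> R" if z: "z \<in> X" for z
  proof (rule ccontr)
    assume zR: "z \<notin> R"
    have "z \<noteq> j" "z \<noteq> l" using z X by auto
    then consider "j < z" "z < l" | "z < j \<or> l < z" by linarith
    thus False
    proof cases
      case 1 thus False using si[of z i] z zR xy yi o by auto
    next
      case 2 thus False using sk[of k z] z zR xy xk o by auto
    qed
  qed
  hence "X \<union> {j, l} \<subseteq> R" using jl by blast
  moreover have "card (X \<union> {j, l}) = card R" using fin X o' by auto
  ultimately show False using ne fin card_subset_eq by blast
qed

text \<open>One set is exchanged for another, so the size is kept. The sum of all labels drops by
  \<open>(j + l) - (i + k)\<close>, which makes descent by lowering flips terminate.\<close>

lemma full_lowering_flip:
  assumes C: "full {1..n} m C" and fl: "lowering_flip n m C C'"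
  shows "full {1..n} m C'" "raising_flip n m C' C" "(\<Sum>S\<in>C'. \<Sum>S) < (\<Sum>S\<in>C. \<Sum>S)"
proof -
  note F = fullD[OF C]
  obtain X i j k l where fr: "flip_frame n m C X i j k l" and jl: "X \<union> {j, l} \<in> C" and ik: "X \<union> {i, k} \<notin> C"
    and C': "C' = (C - {X \<union> {j, l}}) \<union> {X \<union> {i, k}}"
    using fl unfolding lowering_flip_def by blast
  have o: "1 \<le> i" "i < j" "j < k" "k < l" "l \<le> n" and X: "X \<subseteq> {1..n} - {i, j, k, l}" "card X + 2 = m"
    and mem: "X \<union> {i, j} \<in> C" "X \<union> {k, l} \<in> C" "X \<union> {i, l} \<in> C" "X \<union> {j, k} \<in> C"
    using fr unfolding flip_frame_def by auto
  have Xn: "i \<notin> X" "j \<notin> X" "k \<notin> X" "l \<notin> X" and finX: "finite X" using X finite_subset by auto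
  have cik: "card (X \<union> {i, k}) = m" "X \<union> {i, k} \<subseteq> {1..n}" using X Xn finX o by auto
  have nc: "\<not> crosses (X \<union> {i, k}) R" if R: "R \<in> C - {X \<union> {j, l}}" for R
    using flip_not_crosses[OF finX F(9)[of R] _ o(2-4) Xn] F(10)[OF mem(1), of R] F(10)[OF mem(2), of R]
      F(10)[OF mem(3), of R] F(10)[OF mem(4), of R] F(8)[of R] X(2) R by auto
  have "noncrossing C'" unfolding noncrossing_def C'
  proof (intro ballI)
    fix A B assume "A \<in> C - {X \<union> {j, l}} \<union> {X \<union> {i, k}}" "B \<in> C - {X \<union> {j, l}} \<union> {X \<union> {i, k}}"
    thus "\<not> crosses A B" using nc[of A] nc[of B] F(10)[of A B] crosses_sym[of A B] by auto
  qed
  moreover have "C' \<subseteq> {S. S \<subseteq> {1..n} \<and> card S = m}" using F(6) cik unfolding C' by blast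
  moreover have "card C' = card C"
    using F(5) jl ik card_Suc_Diff1[OF F(5) jl] unfolding C' by simp
  ultimately show "full {1..n} m C'" unfolding full_def using F(1,2,4) by simp
  have n1: "X \<union> {j, l} \<noteq> X \<union> {i, k}" using ik jl by auto
  have n2: "X \<union> {j, l} \<noteq> X \<union> {i, j}" "X \<union> {j, l} \<noteq> X \<union> {k, l}" "X \<union> {j, l} \<noteq> X \<union> {i, l}" "X \<union> {j, l} \<noteq> X \<union> {j, k}"
    using Xn o by auto
  have "flip_frame n m C' X i j k l" using fr n2 unfolding flip_frame_def C' by auto
  moreover have "X \<union> {i, k} \<in> C'" "X \<union> {j, l} \<notin> C'" "C = (C' - {X \<union> {i, k}}) \<union> {X \<union> {j, l}}"
    using n1 jl ik unfolding C' by auto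
  ultimately show "raising_flip n m C' C" unfolding raising_flip_def by blast
  have "(\<Sum>S\<in>C'. \<Sum>S) = (\<Sum>S\<in>C - {X \<union> {j, l}}. \<Sum>S) + \<Sum>(X \<union> {i, k})"
    using F(5) ik unfolding C' by simp
  moreover have "(\<Sum>S\<in>C. \<Sum>S) = \<Sum>(X \<union> {j, l}) + (\<Sum>S\<in>C - {X \<union> {j, l}}. \<Sum>S)"
    using sum.remove[OF F(5) jl] by blast
  moreover have "\<Sum>(X \<union> {i, k}) = \<Sum>X + (i + k)" "\<Sum>(X \<union> {j, l}) = \<Sum>X + (j + l)"
    using sum.union_disjoint[OF finX, of "{i, k}" "\<lambda>x. x"] sum.union_disjoint[OF finX, of "{j, l}" "\<lambda>x. x"]
      Xn o by auto
  ultimately show "(\<Sum>S\<in>C'. \<Sum>S) < (\<Sum>S\<in>C. \<Sum>S)" using o by simp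
qed

text \<open>Lowering flips end at \<open>IS n m\<close> because the label sum cannot decrease
  forever; the same path backwards consists of raising flips.\<close>

lemma flips_to_IS:
  assumes "full {1..n} m C"
  shows "(four_flip n m)\<^sup>*\<^sup>* C (IS n m) \<and> (four_flip n m)\<^sup>*\<^sup>* (IS n m) C"
  using assms
proof (induction "\<Sum>S\<in>C. \<Sum>S" arbitrary: C rule: less_induct)
  case less
  show ?case
  proof (cases "C = IS n m")
    case False
    then obtain C' where fl: "lowering_flip n m C C'" using ex_lowering_flip less.prems by blast
    note f = full_lowering_flip[OF less.prems fl]
    have "four_flip n m C C'" "four_flip n m C' C" using fl f(2) unfolding four_flip_def by auto
    moreover have "(four_flip n m)\<^sup>*\<^sup>* C' (IS n m) \<and> (four_flip n m)\<^sup>*\<^sup>* (IS n m) C'"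
      using less.hyps[OF f(3,1)] .
    ultimately show ?thesis
      by (meson converse_rtranclp_into_rtranclp rtranclp.rtrancl_into_rtrancl)
  qed simp
qed

text \<open>\<open>IS n m\<close> attains the size bound, so maximum cardinality means exactly the
  size required by \<open>full\<close>.\<close>

lemma max_ws_collection_full:
  assumes m: "m \<le> n" and C: "max_ws_collection n m C"
  shows "full {1..n} m C"
proof -
  have D: "C \<subseteq> Delta n m" "ws_collection C" "\<And>D. D \<subseteq> Delta n m \<Longrightarrow> ws_collection D \<Longrightarrow> card D \<le> card C"
    using C unfolding max_ws_collection_def by auto
  have Delta: "Delta n m = {S. S \<subseteq> {1..n} \<and> card S = m}" unfolding Delta_def by simp
  have nc: "noncrossing C" using ws_collection_iff D by blast
  note I = fullD[OF full_IS[OF m]]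
  have "IS n m \<subseteq> Delta n m" using I(6) Delta by simp
  hence "card (IS n m) \<le> card C" using D(3) ws_collection_iff I(3) by blast
  moreover have "card C \<le> m * (card {1..n} - m) + 1"
    using card_noncrossing_le[of "{1..n}" C m] nc D(1) m Delta by simp
  ultimately show ?thesis unfolding full_def using I(4) nc D(1) m Delta by simp
qed

theorem theorem11p1:
  fixes n m :: nat
  assumes "m \<le> n"
  shows "(\<forall>C. max_ws_collection n m C \<and> C \<noteq> IS n m \<longrightarrow> (\<exists>C'. lowering_flip n m C C'))
       \<and> (\<forall>C D. max_ws_collection n m C \<and> max_ws_collection n m D
            \<longrightarrow> (four_flip n m)\<^sup>*\<^sup>* C D)"
proof (intro conjI allI impI)
  fix C assume "max_ws_collection n m C \<and> C \<noteq> IS n m"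
  thus "\<exists>C'. lowering_flip n m C C'"
    using ex_lowering_flip max_ws_collection_full[OF assms] by simp
next
  fix C D assume "max_ws_collection n m C \<and> max_ws_collection n m D"
  hence "full {1..n} m C" "full {1..n} m D" using max_ws_collection_full[OF assms] by simp_all
  thus "(four_flip n m)\<^sup>*\<^sup>* C D" using flips_to_IS rtranclp_trans by meson
qed

end
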